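(* Let $G$ be the group given by the following presentation. Generators: $e_i,a_i,b_i$ for $i\in\{0,1,2,3\}$, and $u_{ij},v_{ij},w_{ij}$ for $0\le i<j\le3$. Write $y_i=[a_i,b_i]$ and $y_{ij}=[[u_{ij},v_{ij}],w_{ij}]$. Relations: $$e_i^{3^{2i}}=y_i\ \text{ for } i\in\{0,1,2,3\},$$ $$e_j^{3^{12-i}}e_i^{3^{12-j}}=y_{ij}^{3^{12-2i-2j}}\ \text{ for }(i,j)\in\{(0,1),(0,2),(1,3),(2,3)\}.$$ Let $\omega=[[e_2,e_1],e_0]^{3^9}\in G$. Then $\omega\notin\gamma_7(G)$ and $\omega^3\in\gamma_7(G)$.
   Context: Commutators are $[g,h]=g^{-1}h^{-1}gh$. For a group $G$, $\gamma_n(G)$ is the $n$th term of the lower central series ($\gamma_1(G)=G$, $\gamma_{n+1}(G)=[\gamma_n(G),G]$). *)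

theory Defs
  imports "HOL-Algebra.Generated_Groups"
begin

section \<open>Free groups\<close>

text \<open>
  The letter \<open>(x, True)\<close> stands for the generator \<open>x\<close> and \<open>(x, False)\<close> for its inverse.  The free
  group on \<open>X\<close> consists of the reduced words with letters from \<open>X\<close> and its formal inverses; the
  product is concatenation followed by free reduction.
\<close>

type_synonym 'a word = "('a \<times> bool) list"

fun inv_letter :: "'a \<times> bool \<Rightarrow> 'a \<times> bool" where
  "inv_letter (x, b) = (x, \<not> b)"

fun reduced :: "'a word \<Rightarrow> bool" where
  "reduced (l # m # w) \<longleftrightarrow> m \<noteq> inv_letter l \<and> reduced (m # w)"
| "reduced _ \<longleftrightarrow> True"

fun cons_letter :: "'a \<times> bool \<Rightarrow> 'a word \<Rightarrow> 'a word" where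
  "cons_letter l [] = [l]"
| "cons_letter l (m # w) = (if m = inv_letter l then w else l # m # w)"

definition free_group :: "'a set \<Rightarrow> 'a word monoid" where
  "free_group X =
     \<lparr>carrier = {w \<in> lists (X \<times> UNIV). reduced w},
      monoid.mult = (\<lambda>u v. foldr cons_letter u v),
      one = []\<rparr>"

definition free_gen :: "'a \<Rightarrow> 'a word" where
  "free_gen x = [(x, True)]"

lemma inv_letter_inv_letter [simp]: "inv_letter (inv_letter l) = l"
  by (cases l) simp

lemma inv_letter_neq [simp]: "inv_letter l \<noteq> l" "l \<noteq> inv_letter l"
  by (cases l; simp)+

lemma inv_letter_in [simp]: "inv_letter l \<in> X \<times> UNIV \<longleftrightarrow> l \<in> X \<times> UNIV"
  by (cases l) auto

lemma reduced_ConsD: "reduced (l # w) \<Longrightarrow> reduced w"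
  by (cases w) auto

lemma reduced_cons_letter: "reduced w \<Longrightarrow> reduced (cons_letter l w)"
  by (cases w) (auto dest: reduced_ConsD)

lemma cons_letter_in_lists:
  "l \<in> A \<Longrightarrow> w \<in> lists A \<Longrightarrow> cons_letter l w \<in> lists A"
  by (cases w) auto

lemma reduced_foldr: "reduced v \<Longrightarrow> reduced (foldr cons_letter u v)"
  by (induction u) (auto intro: reduced_cons_letter)

lemma foldr_in_lists:
  "u \<in> lists A \<Longrightarrow> v \<in> lists A \<Longrightarrow> foldr cons_letter u v \<in> lists A"
  by (induction u) (auto simp: cons_letter_in_lists simp del: in_lists_conv_set)

lemma cons_letter_reduced: "reduced (l # w) \<Longrightarrow> cons_letter l w = l # w"
  by (cases w) auto

lemma cons_letter_inv:
  "reduced w \<Longrightarrow> cons_letter l (cons_letter (inv_letter l) w) = w"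
  by (cases w) (auto simp: cons_letter_reduced)

lemma foldr_cons_letter:
  "reduced v \<Longrightarrow>
   foldr cons_letter (cons_letter l u) v = cons_letter l (foldr cons_letter u v)"
  by (cases u) (auto simp: reduced_foldr cons_letter_inv)

lemma foldr_assoc:
  "reduced v \<Longrightarrow> reduced w \<Longrightarrow>
   foldr cons_letter (foldr cons_letter u v) w = foldr cons_letter u (foldr cons_letter v w)"
  by (induction u) (auto simp: foldr_cons_letter)

lemma foldr_Nil: "reduced u \<Longrightarrow> foldr cons_letter u [] = u"
  by (induction u) (use reduced_ConsD in \<open>force simp: cons_letter_reduced simp del: reduced.simps\<close>)+

lemma foldr_inv_word:
  "reduced v \<Longrightarrow> foldr cons_letter (rev (map inv_letter u)) (foldr cons_letter u v) = v"
proof (induction u arbitrary: v)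
  case (Cons l u)
  have "cons_letter (inv_letter l) (cons_letter l (foldr cons_letter u v)) = foldr cons_letter u v"
    using cons_letter_inv[of _ "inv_letter l"] Cons.prems by (simp add: reduced_foldr)
  then show ?case using Cons by simp
qed simp

theorem group_free_group: "group (free_group X)"
proof (rule groupI)
  fix u assume u: "u \<in> carrier (free_group X)"
  let ?v = "foldr cons_letter (rev (map inv_letter u)) []"
  have "set u \<subseteq> X \<times> UNIV" using u by (auto simp: free_group_def)
  then have "rev (map inv_letter u) \<in> lists (X \<times> UNIV)" by fastforce
  then have "?v \<in> lists (X \<times> UNIV)" by (intro foldr_in_lists) auto
  then have "?v \<in> carrier (free_group X)" by (auto simp: free_group_def reduced_foldr)
  moreover have "?v \<otimes>\<^bsub>free_group X\<^esub> u = \<one>\<^bsub>free_group X\<^esub>"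
    using u foldr_inv_word[of "[]" u]
    by (simp add: free_group_def foldr_assoc foldr_Nil)
  ultimately show "\<exists>v\<in>carrier (free_group X). v \<otimes>\<^bsub>free_group X\<^esub> u = \<one>\<^bsub>free_group X\<^esub>" by blast
qed (simp_all add: free_group_def reduced_foldr foldr_assoc foldr_in_lists del: in_lists_conv_set)

lemma free_gen_closed: "x \<in> X \<Longrightarrow> free_gen x \<in> carrier (free_group X)"
  by (simp add: free_group_def free_gen_def)

section \<open>Group presentations\<close>

definition normal_closure :: "('a, 'b) monoid_scheme \<Rightarrow> 'a set \<Rightarrow> 'a set" where
  "normal_closure G R =
     generate G {g \<otimes>\<^bsub>G\<^esub> r \<otimes>\<^bsub>G\<^esub> inv\<^bsub>G\<^esub> g | g r. g \<in> carrier G \<and> r \<in> R}"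

text \<open>A pair \<open>(l, r)\<close> in \<open>R\<close> stands for the relation \<open>l = r\<close>.\<close>

definition relation_closure :: "'a set \<Rightarrow> ('a word \<times> 'a word) set \<Rightarrow> 'a word set" where
  "relation_closure X R = normal_closure (free_group X)
     ((\<lambda>(l, r). l \<otimes>\<^bsub>free_group X\<^esub> inv\<^bsub>free_group X\<^esub> r) ` R)"

definition presented_group :: "'a set \<Rightarrow> ('a word \<times> 'a word) set \<Rightarrow> 'a word set monoid" where
  "presented_group X R = free_group X Mod relation_closure X R"

definition presented_gen :: "'a set \<Rightarrow> ('a word \<times> 'a word) set \<Rightarrow> 'a \<Rightarrow> 'a word set" where
  "presented_gen X R x = relation_closure X R #>\<^bsub>free_group X\<^esub> free_gen x"

lemma normal_normal_closure:
  fixes G (structure)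
  assumes "group G" and R: "R \<subseteq> carrier G"
  shows "normal_closure G R \<lhd> G"
proof -
  interpret group G by fact
  show ?thesis unfolding normal_closure_def
  proof (rule normal_generateI, goal_cases)
    case 1 then show ?case using R by auto
  next
    case (2 h g)
    then obtain k r where "k \<in> carrier G" "r \<in> R" and h: "h = k \<otimes> r \<otimes> inv k" by blast
    moreover have "g \<otimes> h \<otimes> inv g = (g \<otimes> k) \<otimes> r \<otimes> inv (g \<otimes> k)"
      using calculation 2 R by (auto simp: m_assoc inv_mult_group subset_iff)
    ultimately show ?case using 2 by (smt (verit) mem_Collect_eq m_closed)
  qed
qed

theorem group_presented_group:
  assumes "R \<subseteq> carrier (free_group X) \<times> carrier (free_group X)"
  shows "group (presented_group X R)"
proof -
  interpret F: group "free_group X" by (rule group_free_group)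
  show ?thesis unfolding presented_group_def relation_closure_def
    using assms by (intro normal.factorgroup_is_group normal_normal_closure group_free_group) auto
qed

section \<open>Commutators and the lower central series\<close>

text \<open>This is not the convention \<open>g h g\<inverse> h\<inverse>\<close> underlying \<^const>\<open>derived\<close>.\<close>

definition commutator :: "('a, 'b) monoid_scheme \<Rightarrow> 'a \<Rightarrow> 'a \<Rightarrow> 'a" where
  "commutator G g h = inv\<^bsub>G\<^esub> g \<otimes>\<^bsub>G\<^esub> inv\<^bsub>G\<^esub> h \<otimes>\<^bsub>G\<^esub> g \<otimes>\<^bsub>G\<^esub> h"

text \<open>The series is indexed from \<open>1\<close>; the value at \<open>0\<close> is a dummy.\<close>

fun lower_central :: "('a, 'b) monoid_scheme \<Rightarrow> nat \<Rightarrow> 'a set" where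
  "lower_central G 0 = carrier G"
| "lower_central G (Suc 0) = carrier G"
| "lower_central G (Suc (Suc n)) =
     generate G {commutator G x g | x g. x \<in> lower_central G (Suc n) \<and> g \<in> carrier G}"

section \<open>The presentation\<close>

text \<open>
  The symbols \<open>Ge i, Ga i, Gb i, Gu i j, Gv i j, Gw i j\<close> name the generators
  \<open>e\<^sub>i, a\<^sub>i, b\<^sub>i, u\<^sub>i\<^sub>j, v\<^sub>i\<^sub>j, w\<^sub>i\<^sub>j\<close>; \<open>gens\<close> selects the index range of the presentation.
\<close>

datatype gen = Ge nat | Ga nat | Gb nat | Gu nat nat | Gv nat nat | Gw nat nat

definition gens :: "gen set" where
  "gens = {Ge i | i. i \<le> 3} \<union> {Ga i | i. i \<le> 3} \<union> {Gb i | i. i \<le> 3}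
     \<union> {Gu i j | i j. i < j \<and> j \<le> 3} \<union> {Gv i j | i j. i < j \<and> j \<le> 3} \<union> {Gw i j | i j. i < j \<and> j \<le> 3}"

abbreviation FG :: "gen word monoid" where
  "FG \<equiv> free_group gens"

definition y_single :: "nat \<Rightarrow> gen word" where
  "y_single i = commutator FG (free_gen (Ga i)) (free_gen (Gb i))"

definition y_pair :: "nat \<Rightarrow> nat \<Rightarrow> gen word" where
  "y_pair i j = commutator FG (commutator FG (free_gen (Gu i j)) (free_gen (Gv i j))) (free_gen (Gw i j))"

text \<open>All natural-number subtractions below have non-negative results.\<close>

definition rels :: "(gen word \<times> gen word) set" where
  "rels =
     {(free_gen (Ge i) [^]\<^bsub>FG\<^esub> (3 ^ (2 * i) :: nat), y_single i) | i. i \<in> {0, 1, 2, 3}}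
   \<union> {(free_gen (Ge j) [^]\<^bsub>FG\<^esub> (3 ^ (12 - i) :: nat) \<otimes>\<^bsub>FG\<^esub> free_gen (Ge i) [^]\<^bsub>FG\<^esub> (3 ^ (12 - j) :: nat),
       y_pair i j [^]\<^bsub>FG\<^esub> (3 ^ (12 - 2 * i - 2 * j) :: nat)) | i j.
       (i, j) \<in> {(0, 1), (0, 2), (1, 3), (2, 3)}}"

lemma rels_closed: "rels \<subseteq> carrier FG \<times> carrier FG"
proof -
  interpret group FG by (rule group_free_group)
  have comm: "commutator FG g h \<in> carrier FG" if "g \<in> carrier FG" "h \<in> carrier FG" for g h
    using that by (simp add: commutator_def)
  have "Ge i \<in> gens" "Ga i \<in> gens" "Gb i \<in> gens" if "i \<le> 3" for i
    using that by (auto simp: gens_def)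
  then have 1: "free_gen (Ge i) \<in> carrier FG" "y_single i \<in> carrier FG" if "i \<le> 3" for i
    using that by (auto simp: y_single_def intro!: comm free_gen_closed)
  have "Gu i j \<in> gens" "Gv i j \<in> gens" "Gw i j \<in> gens" if "i < j" "j \<le> 3" for i j
    using that by (auto simp: gens_def)
  then have 2: "y_pair i j \<in> carrier FG" if "i < j" "j \<le> 3" for i j
    using that by (auto simp: y_pair_def intro!: comm free_gen_closed)
  show ?thesis
    unfolding rels_def by (auto intro!: m_closed nat_pow_closed 1 2)
qed

end

theory Submission
  imports Defs Complex_Main "HOL-Library.Function_Algebras"
begin

text \<open>
  Write \<open>\<gamma>\<^sub>k\<close> for the lower central series of \<open>G\<close> and \<open>x = [e\<^sub>2, e\<^sub>1]\<close>.  The relations put \<open>e\<^sub>i\<close>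
  to the power \<open>9\<^sup>i\<close> into \<open>\<gamma>\<^sub>2\<close>.

  \<^bold>\<open>The cube.\<close>  By relation \<open>(2,3)\<close> the power \<open>e\<^sub>2^(3^10)\<close> equals \<open>e\<^sub>3^(-3^11) y\<^sub>2\<^sub>3^27\<close> modulo \<open>\<gamma>\<^sub>4\<close>, and
  by relation \<open>(1,3)\<close> \<open>e\<^sub>3^(3^11) = y\<^sub>1\<^sub>3^81 e\<^sub>1^(-3^9)\<close>.  All factors on the right commute with \<open>e\<^sub>1\<close>
  modulo \<open>\<gamma>\<^sub>5\<close>, because \<open>[y^9, e\<^sub>1] = [y, e\<^sub>1^9]\<close> modulo \<open>\<gamma>\<^sub>5\<close> for \<open>y\<close> in \<open>\<gamma>\<^sub>3\<close>.  Hence \<open>[e\<^sub>2^(3^10), e\<^sub>1]\<close> is in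
  \<open>\<gamma>\<^sub>5\<close>, so is \<open>x^(3^10)\<close>, and as \<open>e\<^sub>0\<close> is in \<open>\<gamma>\<^sub>2\<close>, \<open>[x, e\<^sub>0]^(3^10)\<close> is in \<open>\<gamma>\<^sub>7\<close>; the correction terms of the
  power formulas vanish because they have small 3-power order.  With \<open>3^9\<close> in place of \<open>3^10\<close> the first
  step would leave \<open>e\<^sub>3^(3^10)\<close>, which is too small a power for relation \<open>(1,3)\<close>.  This is
  \<open>triple_commutator_torsion\<close>.

  \<^bold>\<open>Non-triviality.\<close>  A series of subgroups \<open>H\<^sub>k\<close> with \<open>[H\<^sub>i, H\<^sub>j] \<subseteq> H\<^sub>i\<^sub>+\<^sub>j\<close> (a strongly central series)
  absorbs the lower central series, so it suffices to map the generators into such a group in a way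
  that sends all relators into \<open>H\<^sub>7\<close> but not the word \<open>\<omega>\<close>
  (\<open>word_value_mem_of_lower_central\<close>).  The group is constructed in two steps.

  First, suppose that \<open>E\<close> has a strongly central series.  The maps from \<open>\<int>\<close> to \<open>E\<close> that are polynomial with
  respect to the series, extended by the translations of \<open>\<int>\<close>, again have one
  (\<open>strongly_central_wreath_series\<close>).  In this larger group an element \<open>y\<close> of \<open>E\<^sub>2\<close> is the commutator of
  \<open>n \<mapsto> y\<^sup>n\<close> with a translation, and an element of \<open>E\<^sub>3\<close> is similarly a triple commutator.  So the
  generators \<open>a, b, u, v, w\<close> may be forgotten: \<open>E\<close> only has to contain elements \<open>e\<^sub>i\<close> with \<open>9\<^sup>i\<close>-th power in
  \<open>E\<^sub>2\<close> and \<open>y\<^sub>i\<^sub>j\<close> in \<open>E\<^sub>3\<close> that satisfy the remaining relations modulo \<open>E\<^sub>7\<close>.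

  Second, let \<open>M\<close> be the free abelian group on the \<open>e\<^sub>i\<close> and on \<open>y\<^sub>0\<^sub>2, y\<^sub>1\<^sub>3, y\<^sub>2\<^sub>3\<close> (and take \<open>y\<^sub>0\<^sub>1\<close> trivial), and let
  \<open>T(p; x, y)\<close> be a trilinear form on \<open>M\<close>, symmetric in \<open>x\<close> and \<open>y\<close>, whose values matter modulo \<open>3^14\<close>.
  Let \<open>p\<close> in \<open>M\<close> act as the translation by \<open>p\<close> together with the quadratic map \<open>x \<mapsto> T(p; x, x)\<close>; these
  elements generate a group \<open>E\<close> of nilpotency class three inside a wreath product, in which
  \<open>[[p, q], s]\<close> is the constant \<open>2 (T(p; q, s) - T(q; p, s))\<close>.  The weights of \<open>M\<close> give a strongly central
  series of \<open>E\<close> as soon as these constants vanish for total weight at least 7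
  (\<open>strongly_central_series\<close>).  If \<open>T(p; p, x) = 0\<close> for the basis vectors \<open>p\<close>, powers of basis vectors are
  computed in \<open>M\<close>, and then a relation holds modulo \<open>E\<^sub>7\<close> once its linear part is in the radical of \<open>T\<close>; the
  commutators of the large powers that occur vanish modulo \<open>3^14\<close>.
  What remains is a form \<open>T\<close> for which these conditions hold while \<open>[[e\<^sub>2, e\<^sub>1], e\<^sub>0]^(3^9)\<close> is not
  divisible by \<open>3^14\<close>: it is written down in \<open>tensor_table\<close>.
\<close>

section \<open>Strongly central series\<close>

text \<open>
  Groups are written additively although they are not commutative, so that the type class of groups
  applies; this is \<open>commutator\<close> in that notation.
\<close>

definition comm :: "'a::group_add \<Rightarrow> 'a \<Rightarrow> 'a" where
  "comm x y = - x - y + x + y"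

text \<open>
  Together with the cancellation rules, these rewrite a term to a reduced word and so decide the
  word problem of free groups; \<open>add_uminus_conv_diff\<close> has to be switched off.
\<close>

lemmas group_nf = add.assoc minus_add diff_conv_add_uminus

lemma comm_add_left: "comm (a + b) c = comm a c + comm (comm a c) b + comm b c"
  for a b c :: "'a::group_add"
  by (simp add: comm_def group_nf del: add_uminus_conv_diff)

lemma comm_add_right: "comm a (b + c) = comm a c + comm a b + comm (comm a b) c"
  for a b c :: "'a::group_add"
  by (simp add: comm_def group_nf del: add_uminus_conv_diff)

lemma minus_comm: "- comm a b = comm b a" for a b :: "'a::group_add"
  by (simp add: comm_def group_nf del: add_uminus_conv_diff)

lemma comm_zero [simp]: "comm 0 a = 0" "comm a 0 = 0" "comm a a = 0" for a :: "'a::group_add"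
  by (simp_all add: comm_def group_nf del: add_uminus_conv_diff)

lemma conj_eq: "- h + x + h = x + comm x h" for h x :: "'a::group_add"
  by (simp add: comm_def group_nf del: add_uminus_conv_diff)

text \<open>
  All terms, \<open>F 0\<close> included, are only asked to be subgroups of the ambient group.  Taking \<open>j = 0\<close> or \<open>j = 1\<close> in
  \<open>comm_mem\<close> shows that they are normalised by \<open>F 0\<close> and that they form a central series of \<open>F 1\<close>.
\<close>

locale strongly_central =
  fixes F :: "nat \<Rightarrow> 'a::group_add set"
  assumes zero_mem: "0 \<in> F k"
    and add_mem: "x \<in> F k \<Longrightarrow> y \<in> F k \<Longrightarrow> x + y \<in> F k"
    and minus_mem: "x \<in> F k \<Longrightarrow> - x \<in> F k"
    and Suc_subset: "F (Suc k) \<subseteq> F k"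
    and comm_mem: "x \<in> F i \<Longrightarrow> y \<in> F j \<Longrightarrow> comm x y \<in> F (i + j)"
begin

lemma diff_mem: "x \<in> F k \<Longrightarrow> y \<in> F k \<Longrightarrow> x - y \<in> F k"
  using add_mem[OF _ minus_mem] by simp

lemma antimono: "i \<le> j \<Longrightarrow> x \<in> F j \<Longrightarrow> x \<in> F i"
  using lift_Suc_antimono_le[of F i j] Suc_subset by blast

lemma comm_mem_le: "x \<in> F i \<Longrightarrow> y \<in> F j \<Longrightarrow> k \<le> i + j \<Longrightarrow> comm x y \<in> F k"
  using antimono comm_mem by blast

lemma conj_mem:
  assumes "x \<in> F k" "h \<in> F j" shows "- h + x + h \<in> F k"
  unfolding conj_eq using assms by (intro add_mem comm_mem_le) auto

lemma conj_mem':
  assumes "x \<in> F k" "h \<in> F j" shows "h + x - h \<in> F k"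
  using conj_mem[OF assms(1) minus_mem[OF assms(2)]] by simp

end

lemma strongly_central_Inter:
  assumes "\<And>d. strongly_central (F d)"
  shows "strongly_central (\<lambda>k. \<Inter>d. F d k)"
proof -
  interpret strongly_central "F d" for d by (rule assms)
  show ?thesis
    by standard (auto intro: zero_mem add_mem minus_mem comm_mem dest: subsetD[OF Suc_subset])
qed

text \<open>
  A perturbation of the arguments by elements one step deeper changes a commutator by an element
  one step deeper.  This makes the first differences of a commutator of two maps behave as in the
  product rule, see \<open>strongly_central_differences\<close>.
\<close>

lemma comm_perturb:
  fixes x y a b :: "'a::group_add"
  shows "- comm x y + comm (x + a) (y + b)
    = - comm x y + ((comm x b + comm x y + comm (comm x y) b)
      + comm (comm x b + comm x y + comm (comm x y) b) a + (comm a b + comm a y + comm (comm a y) b))"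
  by (simp only: comm_add_left[of x a "y + b"] comm_add_right[of x y b] comm_add_right[of a y b])

lemma (in strongly_central) comm_perturb_mem:
  assumes "x \<in> F i" "y \<in> F j" "a \<in> F (Suc i)" "b \<in> F (Suc j)"
  shows "- comm x y + comm (x + a) (y + b) \<in> F (Suc (i + j))"
proof -
  let ?k = "Suc (i + j)"
  have m: "comm x b \<in> F ?k" "comm (comm x y) b \<in> F ?k" "comm a b \<in> F ?k"
    "comm a y \<in> F ?k" "comm (comm a y) b \<in> F ?k" "comm x y \<in> F (i + j)"
    by (rule comm_mem_le comm_mem assms order_refl | simp)+
  have 1: "- comm x y + comm x b + comm x y \<in> F ?k"
    using conj_mem m by blast
  have 2: "comm (comm x b + comm x y + comm (comm x y) b) a \<in> F ?k"
  proof -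
    have "comm x b + comm x y + comm (comm x y) b \<in> F (i + j)"
      using m antimono[of "i+j" ?k] by (intro add_mem) auto
    then show ?thesis by (rule comm_mem_le) (use assms in auto)
  qed
  have "- comm x y + comm (x + a) (y + b)
      = (- comm x y + comm x b + comm x y) + comm (comm x y) b
      + comm (comm x b + comm x y + comm (comm x y) b) a + (comm a b + comm a y + comm (comm a y) b)"
    unfolding comm_perturb by (simp add: add.assoc)
  also have "\<dots> \<in> F ?k" using add_mem[OF add_mem[OF add_mem[OF 1 m(2)] 2] add_mem[OF add_mem[OF m(3,4)] m(5)]] .
  finally show ?thesis .
qed

section \<open>Calculating modulo a term of the series\<close>

text \<open>
  This is the power \<open>x ^ n\<close> in additive notation.
\<close>

primrec nmul :: "nat \<Rightarrow> 'a::group_add \<Rightarrow> 'a" where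
  "nmul 0 x = 0"
| "nmul (Suc n) x = nmul n x + x"

lemma nmul_add: "nmul (m + n) x = nmul m x + nmul n x"
  by (induction n) (simp_all add: add.assoc)

lemma nmul_mult: "nmul (m * n) x = nmul n (nmul m x)"
  by (induction n) (simp_all add: nmul_add add.commute[of m])

lemma nmul_commute: "nmul m (nmul n x) = nmul n (nmul m x)"
  by (simp add: mult.commute flip: nmul_mult)

lemma nmul_minus: "nmul n (- x) = - nmul n x" for x :: "'a::group_add"
proof (induction n)
  case (Suc n)
  have "nmul n x + x = x + nmul n x" using nmul_add[of n 1 x] nmul_add[of 1 n x] by simp
  then show ?case using Suc by (simp add: minus_add)
qed simp

locale group_series = strongly_central +
  assumes F_1 [simp]: "F (Suc 0) = UNIV"
begin

lemma mem_1: "x \<in> F 1" "x \<in> F (Suc 0)"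
  using F_1 by auto

lemma normal_mem: "x \<in> F k \<Longrightarrow> - h + x + h \<in> F k" "x \<in> F k \<Longrightarrow> h + x - h \<in> F k"
  using conj_mem[of x k h 1] conj_mem'[of x k h 1] by simp_all

lemma nmul_mem: "x \<in> F k \<Longrightarrow> nmul n x \<in> F k"
  by (induction n) (auto intro: zero_mem add_mem)

text \<open>
  Equality modulo the normal subgroup \<open>F k\<close>.
\<close>

definition ceq :: "nat \<Rightarrow> 'a \<Rightarrow> 'a \<Rightarrow> bool" where
  "ceq k x y \<longleftrightarrow> - x + y \<in> F k"

lemma ceq_refl [simp]: "ceq k x x"
  by (simp add: ceq_def zero_mem)

lemma ceq_sym: "ceq k x y \<Longrightarrow> ceq k y x"
  unfolding ceq_def using minus_mem[of "- x + y" k] by (simp add: minus_add)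

lemma ceq_trans [trans]: "ceq k x y \<Longrightarrow> ceq k y z \<Longrightarrow> ceq k x z"
  unfolding ceq_def using add_mem[of "- x + y" k "- y + z"] by (simp add: add.assoc)

lemma ceq_add: "ceq k x x' \<Longrightarrow> ceq k y y' \<Longrightarrow> ceq k (x + y) (x' + y')"
proof -
  assume "ceq k x x'" "ceq k y y'"
  then have "(- y + (- x + x') + y) + (- y + y') \<in> F k"
    using add_mem[OF normal_mem(1)] by (simp add: ceq_def)
  then show ?thesis by (simp add: ceq_def minus_add group_nf del: add_uminus_conv_diff)
qed

lemma ceq_minus: "ceq k x y \<Longrightarrow> ceq k (- x) (- y)"
  unfolding ceq_def using normal_mem(2)[OF minus_mem, of "- x + y" k x]
  by (simp add: group_nf del: add_uminus_conv_diff)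

lemma ceq_0: "ceq k x 0 \<longleftrightarrow> x \<in> F k"
  using minus_mem[of x k] minus_mem[of "- x" k] by (auto simp: ceq_def)

lemma ceq_mem: "ceq k x y \<Longrightarrow> y \<in> F k \<Longrightarrow> x \<in> F k"
  using ceq_trans ceq_0 by blast

lemma minus_mem_iff: "- x \<in> F k \<longleftrightarrow> x \<in> F k"
  using minus_mem[of x k] minus_mem[of "- x" k] by auto

lemma ceq_absorb:
  assumes "ceq k x (y + z)" "z \<in> F k" shows "ceq k x y"
  using ceq_trans[OF assms(1) ceq_add[OF ceq_refl]] assms(2) by (metis add.right_neutral ceq_0)

lemma ceq_nmul: "ceq k x y \<Longrightarrow> ceq k (nmul n x) (nmul n y)"
  by (induction n) (auto intro: ceq_add)

lemma ceq_commute: "x \<in> F i \<Longrightarrow> y \<in> F j \<Longrightarrow> k \<le> i + j \<Longrightarrow> ceq k (x + y) (y + x)"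
  using comm_mem_le[of y j x i k] by (simp add: ceq_def comm_def group_nf add.commute[of i] del: add_uminus_conv_diff)

lemma nmul_add_ceq:
  assumes "x \<in> F i" "y \<in> F j" "k \<le> i + j"
  shows "ceq k (nmul n (x + y)) (nmul n x + nmul n y)"
proof (induction n)
  case (Suc n)
  have "ceq k (nmul n (x + y) + (x + y)) (nmul n x + (nmul n y + x) + y)"
    using ceq_add[OF Suc ceq_refl, of "x + y"] by (simp add: add.assoc)
  also have "ceq k (nmul n x + (nmul n y + x) + y) (nmul n x + (x + nmul n y) + y)"
    using assms by (intro ceq_add ceq_refl ceq_commute[of _ j _ i] nmul_mem) auto
  finally show ?case by (simp add: add.assoc)
qed simp

lemma comm_ceq_left:
  assumes "ceq i a a'" "c \<in> F j" "k \<le> i + j"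
  shows "ceq k (comm a c) (comm a' c)"
proof -
  define d where "d = - a + a'"
  have d: "a' = a + d" "d \<in> F i" using assms(1) by (auto simp: d_def ceq_def simp flip: add.assoc)
  have "comm (comm a c) d \<in> F k"
    using comm_mem_le[OF comm_mem_le[OF mem_1(1) assms(2)] d(2), of j k] assms(3) by simp
  moreover have "comm d c \<in> F k" using assms d by (intro comm_mem_le)
  ultimately have "comm (comm a c) d + comm d c \<in> F k" by (rule add_mem)
  then show ?thesis by (simp add: ceq_def d comm_add_left add.assoc)
qed

lemma comm_add_ceq:
  assumes "a \<in> F i" "b \<in> F i'" "c \<in> F j" "k \<le> i + j + i'"
  shows "ceq k (comm (a + b) c) (comm a c + comm b c)"
proof -
  have "comm (comm a c) b \<in> F k"
    using assms comm_mem[OF assms(1,3)] by (intro comm_mem_le) auto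
  then have "ceq k (comm a c + comm (comm a c) b + comm b c) (comm a c + 0 + comm b c)"
    by (intro ceq_add ceq_refl) (simp add: ceq_0)
  then show ?thesis by (simp add: comm_add_left)
qed

text \<open>
  Commutators are linear in an argument of depth \<open>i\<close> up to terms that contain this argument twice.
\<close>

lemma comm_nmul_ceq_linear:
  assumes "a \<in> F i" "c \<in> F j" "k \<le> 2 * i + j"
  shows "ceq k (comm (nmul n a) c) (nmul n (comm a c))"
proof (induction n)
  case (Suc n)
  have "ceq k (comm (nmul n a + a) c) (comm (nmul n a) c + comm a c)"
    using assms by (intro comm_add_ceq[of _ i _ i _ j] nmul_mem) auto
  also have "ceq k \<dots> (nmul n (comm a c) + comm a c)"
    by (intro ceq_add Suc ceq_refl)
  finally show ?case by simp
qed simp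

lemma comm_nmul_ceq_linear_right:
  assumes "a \<in> F i" "c \<in> F j" "k \<le> i + 2 * j"
  shows "ceq k (comm a (nmul n c)) (nmul n (comm a c))"
proof (induction n)
  case (Suc n)
  have "ceq k (comm c a + comm (nmul n c) a) (comm (c + nmul n c) a)"
    using assms by (intro ceq_sym[OF comm_add_ceq[of _ j _ j _ i]] nmul_mem) auto
  moreover have "c + nmul n c = nmul n c + c"
    using nmul_add[of 1 n c] nmul_add[of n 1 c] by simp
  ultimately have "ceq k (- comm (nmul n c + c) a) (- (comm c a + comm (nmul n c) a))"
    by (metis ceq_minus ceq_sym)
  then have "ceq k (comm a (nmul n c + c)) (comm a (nmul n c) + comm a c)"
    by (simp only: minus_add minus_comm)
  also have "ceq k \<dots> (nmul n (comm a c) + comm a c)"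
    by (intro ceq_add Suc ceq_refl)
  finally show ?case by simp
qed simp

text \<open>
  The expansion \<open>[a^n, c] = [a, c]^n [a, c, a]^(n choose 2) [a, c, a, a]^(n choose 3)\<close>, valid modulo
  commutators with four entries \<open>a\<close>, or with three entries \<open>a\<close> and two entries \<open>c\<close>.  It follows from
  \<open>[a^(n+1), c] = [a^n, c] [[a^n, c], a] [a, c]\<close>; the coefficients are those of Pascal's triangle.
\<close>

lemma comm_nmul_ceq:
  fixes n :: nat
  assumes a: "a \<in> F i" and c: "c \<in> F j" and k: "k \<le> 4 * i + j" "k \<le> 3 * i + 2 * j"
  defines "s \<equiv> comm a c"
  defines "t \<equiv> comm s a"
  defines "u \<equiv> comm t a"
  shows "ceq k (comm (nmul n a) c) (nmul n s + nmul (n choose 2) t + nmul (n choose 3) u)"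
proof (induction n)
  case (Suc n)
  have s: "s \<in> F (i + j)" unfolding s_def using a c by (intro comm_mem_le) auto
  have t: "t \<in> F (2 * i + j)" unfolding t_def using a s by (intro comm_mem_le) auto
  have u: "u \<in> F (3 * i + j)" unfolding u_def using a t by (intro comm_mem_le) auto
  let ?X = "comm (nmul n a) c" and ?s = "nmul n s" and ?t = "nmul (n choose 2) t"
    and ?u = "nmul (n choose 3) u" and ?t' = "nmul n t" and ?u' = "nmul (n choose 2) u"
  have "ceq k (comm ?X a) (comm (?s + (?t + ?u)) a)"
    using comm_ceq_left[OF Suc a, of k] by (simp add: add.assoc)
  also have "ceq k \<dots> (comm ?s a + comm (?t + ?u) a)"
    using s t antimono[OF _ u, of "2 * i + j"] a k
    by (intro comm_add_ceq[of _ "i + j" _ "2 * i + j" _ i] add_mem nmul_mem) auto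
  also have "ceq k \<dots> (comm ?s a + (comm ?t a + comm ?u a))"
    using t u a k
    by (intro ceq_add ceq_refl comm_add_ceq[of _ "2 * i + j" _ "3 * i + j" _ i] nmul_mem) auto
  also have "ceq k \<dots> (?t' + (?u' + 0))"
  proof (intro ceq_add)
    show "ceq k (comm ?s a) ?t'"
      unfolding t_def using s a k by (intro comm_nmul_ceq_linear) auto
    show "ceq k (comm ?t a) ?u'"
      unfolding u_def using t a k by (intro comm_nmul_ceq_linear) auto
    show "ceq k (comm ?u a) 0"
      unfolding ceq_0 using k by (intro comm_mem_le[OF nmul_mem[OF u] a]) auto
  qed
  finally have 1: "ceq k (comm ?X a) (?t' + ?u')" by simp
  have "ceq k (comm (nmul (Suc n) a) c) ((?s + ?t + ?u) + (?t' + ?u') + s)"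
    using ceq_add[OF ceq_add[OF Suc 1] ceq_refl[of k s]] by (simp add: comm_add_left s_def)
  also have "ceq k \<dots> (?s + (s + (?t + ?u + (?t' + ?u'))))"
  proof -
    have "?t + ?u + (?t' + ?u') \<in> F (2 * i + j)"
      using t antimono[OF _ u, of "2 * i + j"] by (intro add_mem nmul_mem) auto
    then have "ceq k ((?t + ?u + (?t' + ?u')) + s) (s + (?t + ?u + (?t' + ?u')))"
      using s k by (intro ceq_commute[of _ "2 * i + j" _ "i + j"]) auto
    from ceq_add[OF ceq_refl[of k ?s] this] show ?thesis by (simp add: add.assoc)
  qed
  also have "ceq k \<dots> (?s + (s + (?t + (?t' + ?u) + ?u')))"
  proof -
    have "ceq k (?u + ?t') (?t' + ?u)"
      using t u k by (intro ceq_commute[of _ "3 * i + j" _ "2 * i + j"] nmul_mem) auto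
    from ceq_add[OF ceq_add[OF ceq_refl[of k "?s + s + ?t"] this] ceq_refl[of k ?u']]
    show ?thesis by (simp add: add.assoc)
  qed
  also have "\<dots> = nmul (Suc n) s + nmul (Suc n choose 2) t + nmul (Suc n choose 3) u"
  proof -
    have "Suc n choose 2 = (n choose 2) + n" "Suc n choose 3 = (n choose 3) + (n choose 2)"
      by (simp_all add: numeral_2_eq_2 numeral_3_eq_3)
    then show ?thesis by (simp add: nmul_add add.assoc)
  qed
  finally show ?case .
qed (simp add: numeral_2_eq_2 numeral_3_eq_3)

end

section \<open>The cube of the commutator\<close>

text \<open>
  The centraliser \<open>Z\<close> of \<open>e\<^sub>1\<close> modulo \<open>F 5\<close> is a subgroup that contains \<open>e\<^sub>1\<close>, the term \<open>F 4\<close> and the ninth powers of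
  elements of \<open>F 3\<close>.  The two relations then place \<open>e\<^sub>3^(3^11)\<close> and next \<open>e\<^sub>2^(3^10)\<close> in \<open>Z\<close>.  The passage from there to
  \<open>[e\<^sub>2, e\<^sub>1]^(3^10)\<close> and to \<open>[[e\<^sub>2, e\<^sub>1], e\<^sub>0]^(3^10)\<close> uses \<open>comm_nmul_ceq\<close>, whose correction terms disappear since
  \<open>e\<^sub>1^9\<close> and \<open>e\<^sub>2^81\<close> lie in \<open>F 2\<close>.
\<close>

lemma (in group_series) triple_commutator_torsion:
  assumes e0: "e0 \<in> F 2" and e1: "nmul 9 e1 \<in> F 2" and e2: "nmul 81 e2 \<in> F 2"
    and y: "y13 \<in> F 3" "y23 \<in> F 3"
    and rel13: "nmul (3 ^ 11) e3 + nmul (3 ^ 9) e1 = nmul (3 ^ 4) y13"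
    and rel23: "nmul (3 ^ 10) e3 + nmul (3 ^ 9) e2 = nmul (3 ^ 2) y23"
  shows "nmul (3 ^ 10) (comm (comm e2 e1) e0) \<in> F 7"
proof -
  define Z where "Z = {g. comm g e1 \<in> F 5}"
  have Z_add: "a + b \<in> Z" if "a \<in> Z" "b \<in> Z" for a b
    using that comm_mem_le[of "comm a e1" 5 b 1 5] by (simp add: Z_def comm_add_left add_mem)
  have Z_minus: "- a \<in> Z" if "a \<in> Z" for a
  proof -
    have "comm a e1 + comm (comm a e1) (- a) \<in> F 5"
      using that comm_mem_le[of "comm a e1" 5 "- a" 1 5] by (simp add: Z_def add_mem)
    moreover have "comm a e1 + comm (comm a e1) (- a) + comm (- a) e1 = 0"
      using comm_add_left[of a "- a" e1] by simp
    ultimately show ?thesis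
      using zero_mem[of 5] minus_mem by (metis Z_def add_eq_0_iff mem_Collect_eq)
  qed
  have Z_nmul: "nmul n a \<in> Z" if "a \<in> Z" for n a
    using that Z_add by (induction n) (simp_all add: Z_def zero_mem)
  have Z_9: "nmul 9 g \<in> Z" if g: "g \<in> F 3" for g
  proof -
    have "ceq 5 (comm (nmul 9 g) e1) (nmul 9 (comm g e1))"
      by (rule comm_nmul_ceq_linear[OF g, of _ 1]) auto
    also have "ceq 5 \<dots> (comm g (nmul 9 e1))"
      by (rule ceq_sym[OF comm_nmul_ceq_linear_right[OF g, of _ 1]]) auto
    finally show ?thesis
      using ceq_mem[OF _ comm_mem_le[OF g e1, of 5]] by (simp add: Z_def)
  qed
  have "nmul (3 ^ 11) e3 \<in> Z"
  proof -
    have "nmul (3 ^ 11) e3 = nmul (9 * 9) y13 + - nmul (3 ^ 9) e1"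
      using rel13 by (simp add: eq_diff_eq)
    moreover have "e1 \<in> Z" by (simp add: Z_def zero_mem)
    ultimately show ?thesis
      using Z_add Z_minus Z_nmul Z_9[OF y(1)] nmul_mult[of 9 9] by metis
  qed
  then have "comm (nmul (3 ^ 10) e2) e1 \<in> F 5"
  proof -
    \<comment> \<open>Modulo \<open>F 4\<close>, cubing is additive on \<open>?p\<close> and \<open>?q\<close> because \<open>?q\<close> is in \<open>F 3\<close>.\<close>
    let ?p = "- nmul (3 ^ 10) e3" and ?q = "nmul 9 y23"
    have "nmul (3 ^ 9) e2 = ?p + ?q"
    proof -
      have "?q = nmul (3 ^ 10) e3 + nmul (3 ^ 9) e2" using rel23 by simp
      then show ?thesis by (simp only: minus_add_cancel)
    qed
    then have "nmul (3 ^ 9 * 3) e2 = nmul 3 (?p + ?q)"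
      by (simp only: nmul_mult)
    also have "ceq 4 \<dots> (nmul 3 ?p + nmul 3 ?q)"
      using y by (intro nmul_add_ceq[of _ 1 _ 3] nmul_mem) auto
    also have "\<dots> = - nmul (3 ^ 10 * 3) e3 + nmul 9 (nmul 3 y23)"
      by (simp only: nmul_minus flip: nmul_mult) simp
    finally have "ceq 4 (nmul (3 ^ 10) e2) (- nmul (3 ^ 11) e3 + nmul 9 (nmul 3 y23))"
      by simp
    from comm_ceq_left[OF this, of e1 1 5]
    have "ceq 5 (comm (nmul (3 ^ 10) e2) e1) (comm (- nmul (3 ^ 11) e3 + nmul 9 (nmul 3 y23)) e1)"
      by simp
    moreover have "- nmul (3 ^ 11) e3 + nmul 9 (nmul 3 y23) \<in> Z"
      using \<open>nmul (3 ^ 11) e3 \<in> Z\<close> y by (intro Z_add Z_minus Z_9 nmul_mem)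
    ultimately show ?thesis by (auto simp: Z_def intro: ceq_mem)
  qed
  define x where "x = comm e2 e1"
  have x: "x \<in> F 2" unfolding x_def by (rule comm_mem_le[of _ 1 _ 1]) auto
  have x9: "nmul 9 x \<in> F 3"
  proof (rule ceq_mem)
    show "ceq 3 (nmul 9 x) (comm e2 (nmul 9 e1))"
      unfolding x_def by (rule ceq_sym[OF comm_nmul_ceq_linear_right[of _ 1 _ 1]]) auto
    show "comm e2 (nmul 9 e1) \<in> F 3" using e1 by (intro comm_mem_le[of _ 1 _ 2]) auto
  qed
  have comm81: "nmul 81 (comm g e2) \<in> F 5" if g: "g \<in> F 3" for g
  proof (rule ceq_mem)
    show "ceq 5 (nmul 81 (comm g e2)) (comm g (nmul 81 e2))"
      by (rule ceq_sym[OF comm_nmul_ceq_linear_right[OF g, of _ 1]]) auto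
    show "comm g (nmul 81 e2) \<in> F 5" using g e2 by (intro comm_mem_le[of _ 3 _ 2]) auto
  qed
  \<comment> \<open>Here \<open>t\<close> is the second term in the expansion of \<open>[e\<^sub>2^81, e\<^sub>1]\<close>.  Its power \<open>t^81\<close> agrees with
    \<open>[x, e\<^sub>2^81]\<close> modulo \<open>F 5\<close>, which is killed by 9 since \<open>x^9\<close> is in \<open>F 3\<close>.\<close>
  define t where "t = comm x e2"
  have t: "t \<in> F 3" unfolding t_def using x by (intro comm_mem_le[of _ 2 _ 1]) auto
  have t729: "nmul 729 t \<in> F 5"
  proof -
    define s where "s = comm e2 x"
    have s: "s \<in> F 3" unfolding s_def using x by (intro comm_mem_le[of _ 1 _ 2]) auto
    have 1: "ceq 5 (comm (nmul 81 e2) x)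
      (nmul 81 s + nmul (81 choose 2) (comm s e2) + nmul (81 choose 3) (comm (comm s e2) e2))"
      unfolding s_def by (rule comm_nmul_ceq[OF _ x, of _ 1]) auto
    have 2: "nmul (81 choose 2) (comm s e2) \<in> F 5"
      using nmul_mem[OF comm81[OF s], of 40] by (simp add: choose_two flip: nmul_mult)
    have 3: "nmul (81 choose 3) (comm (comm s e2) e2) \<in> F 5"
    proof -
      have "comm s e2 \<in> F 4" by (rule comm_mem_le[OF s, where j = 1]) auto
      from comm_mem_le[OF this, where j = 1 and k = 5] show ?thesis by (intro nmul_mem) auto
    qed
    have "ceq 5 (comm (nmul 81 e2) x) (nmul 81 s)"
      by (rule ceq_absorb[OF ceq_absorb[OF 1 3] 2])
    then have "ceq 5 (nmul 9 (nmul 81 s)) (nmul 9 (comm (nmul 81 e2) x))"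
      by (rule ceq_nmul[OF ceq_sym])
    also have "ceq 5 \<dots> (comm (nmul 81 e2) (nmul 9 x))"
      using e2 x by (intro ceq_sym[OF comm_nmul_ceq_linear_right[of _ 2 _ 2]]) auto
    finally have "nmul 9 (nmul 81 s) \<in> F 5"
      by (rule ceq_mem) (intro comm_mem_le[OF e2 x9]; simp)
    moreover have "t = - s" by (simp add: t_def s_def minus_comm)
    ultimately show ?thesis by (simp add: nmul_minus minus_mem_iff flip: nmul_mult)
  qed
  have "nmul (3 ^ 10) x \<in> F 5"
  proof -
    let ?s = "nmul 81 x" and ?t = "nmul (81 choose 2) t" and ?u = "nmul (81 choose 3) (comm t e2)"
    \<comment> \<open>The expansion is used for the exponent 81 only: after that the base \<open>e\<^sub>2^81\<close> is in \<open>F 2\<close>, and taking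
      its 729th power commutes with the commutator modulo \<open>F 5\<close>.\<close>
    have "(3 ^ 10 :: nat) = 81 * 729" by simp
    then have 1: "comm (nmul 729 (nmul 81 e2)) e1 \<in> F 5"
      using \<open>comm (nmul (3 ^ 10) e2) e1 \<in> F 5\<close> by (simp only: nmul_mult)
    have 2: "ceq 5 (comm (nmul 729 (nmul 81 e2)) e1) (nmul 729 (comm (nmul 81 e2) e1))"
      using e2 by (intro comm_nmul_ceq_linear[of _ 2 _ 1]) auto
    have 3: "ceq 5 (comm (nmul 81 e2) e1) (?s + ?t + ?u)"
      unfolding t_def x_def by (rule comm_nmul_ceq[of _ 1 _ 1]) auto
    have "nmul 729 (?s + ?t + ?u) \<in> F 5"
      by (rule ceq_mem[OF ceq_trans[OF ceq_sym[OF ceq_nmul[OF 3]] ceq_sym[OF 2]] 1])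
    then have 4: "nmul 729 (?s + (?t + ?u)) \<in> F 5" by (simp only: add.assoc)
    have 5: "ceq 5 (nmul 729 (?s + (?t + ?u))) (nmul 729 ?s + nmul 729 (?t + ?u))"
      using x t by (intro nmul_add_ceq[of _ 2 _ 3] add_mem nmul_mem comm_mem_le[OF t, of _ 1]) auto
    have 6: "ceq 5 (nmul 729 (?t + ?u)) (nmul 729 ?t + nmul 729 ?u)"
      using t by (intro nmul_add_ceq[of _ 3 _ 3] nmul_mem comm_mem_le[OF t, of _ 1]) auto
    have 7: "nmul 729 ?t \<in> F 5"
      using nmul_mem[OF t729] by (simp only: nmul_commute[of 729])
    have 8: "nmul 729 ?u \<in> F 5"
      using nmul_mem[OF nmul_mem[OF comm81[OF t], of 9], of "81 choose 3"]
      by (simp add: nmul_commute[of 729] flip: nmul_mult[of 81 9])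
    have "nmul 729 (?t + ?u) \<in> F 5"
      by (rule ceq_mem[OF 6 add_mem[OF 7 8]])
    then have "nmul 729 ?s \<in> F 5"
      by (rule ceq_mem[OF ceq_sym[OF ceq_absorb[OF 5]] 4])
    then show ?thesis by (simp flip: nmul_mult)
  qed
  define w where "w = comm x e0"
  have w: "w \<in> F 4" unfolding w_def using x e0 by (intro comm_mem_le[of _ 2 _ 2]) auto
  have w1: "ceq 7 (comm (nmul (3 ^ 10) x) e0)
    (nmul (3 ^ 10) w + nmul (3 ^ 10 choose 2) (comm w x) + nmul (3 ^ 10 choose 3) (comm (comm w x) x))"
    unfolding w_def by (rule comm_nmul_ceq[OF x e0]) auto
  have w2: "comm (nmul (3 ^ 10) x) e0 \<in> F 7"
    using \<open>nmul (3 ^ 10) x \<in> F 5\<close> e0 by (intro comm_mem_le[of _ 5 _ 2]) auto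
  have w3: "nmul (3 ^ 10 choose 2) (comm w x) \<in> F 7"
  proof -
    have "ceq 7 (nmul 9 (comm w x)) (comm w (nmul 9 x))"
      using w x by (intro ceq_sym[OF comm_nmul_ceq_linear_right[of _ 4 _ 2]]) auto
    then have "nmul 9 (comm w x) \<in> F 7"
      by (rule ceq_mem) (intro comm_mem_le[OF w x9]; simp)
    moreover have "(3 ^ 10 choose 2 :: nat) = 9 * (6561 * 29524)" by (simp add: choose_two)
    ultimately show ?thesis by (simp only: nmul_mult nmul_mem)
  qed
  have w4: "nmul (3 ^ 10 choose 3) (comm (comm w x) x) \<in> F 7"
  proof -
    have "comm w x \<in> F 6" by (rule comm_mem_le[OF w x]) simp
    from comm_mem_le[OF this x, of 7] show ?thesis by (intro nmul_mem) auto
  qed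
  have "nmul (3 ^ 10) w \<in> F 7"
    by (rule ceq_mem[OF ceq_sym[OF ceq_absorb[OF ceq_absorb[OF w1 w4] w3]] w2])
  then show ?thesis by (simp only: w_def x_def)
qed

section \<open>The lower central series of an additive group\<close>

inductive_set subgroup_hull :: "'a::group_add set \<Rightarrow> 'a set" for A where
  hull_zero: "0 \<in> subgroup_hull A"
| hull_base: "a \<in> A \<Longrightarrow> a \<in> subgroup_hull A"
| hull_add: "x \<in> subgroup_hull A \<Longrightarrow> y \<in> subgroup_hull A \<Longrightarrow> x + y \<in> subgroup_hull A"
| hull_minus: "x \<in> subgroup_hull A \<Longrightarrow> - x \<in> subgroup_hull A"

text \<open>
  The value at \<open>0\<close> is chosen as in \<open>lower_central\<close>.
\<close>

fun lower_central_add :: "nat \<Rightarrow> 'a::group_add set" where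
  "lower_central_add 0 = UNIV"
| "lower_central_add (Suc 0) = UNIV"
| "lower_central_add (Suc (Suc n)) = subgroup_hull {comm x g | x g. x \<in> lower_central_add (Suc n)}"

lemma lower_central_add_closed:
  "0 \<in> lower_central_add n"
  "x \<in> lower_central_add n \<Longrightarrow> y \<in> lower_central_add n \<Longrightarrow> x + y \<in> lower_central_add n"
  "x \<in> lower_central_add n \<Longrightarrow> - x \<in> lower_central_add n"
  by (cases n rule: lower_central_add.cases; auto intro: subgroup_hull.intros)+

lemma conj_comm: "- h + comm x y + h = comm (- h + x + h) (- h + y + h)" for h :: "'a::group_add"
  by (simp add: comm_def group_nf del: add_uminus_conv_diff)

lemma lower_central_add_normal:
  "x \<in> lower_central_add n \<Longrightarrow> - h + x + h \<in> lower_central_add n"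
proof (induction n arbitrary: x h rule: induct_nat_012)
  case (ge2 n)
  show ?case
    using ge2(3) unfolding lower_central_add.simps
  proof (induction rule: subgroup_hull.induct)
    case (hull_base a)
    then obtain x g where "a = comm x g" "x \<in> lower_central_add (Suc n)" by blast
    then show ?case
      using ge2(2) by (auto simp: conj_comm intro!: subgroup_hull.hull_base)
  next
    case (hull_add x y)
    have "- h + (x + y) + h = (- h + x + h) + (- h + y + h)"
      by (simp add: group_nf del: add_uminus_conv_diff)
    then show ?case using subgroup_hull.hull_add[OF hull_add.IH] by (simp only:)
  next
    case (hull_minus x)
    have "- h + - x + h = - (- h + x + h)"
      by (simp add: group_nf del: add_uminus_conv_diff)
    then show ?case using subgroup_hull.hull_minus[OF hull_minus.IH] by (simp only:)
  qed (simp add: subgroup_hull.hull_zero)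
qed simp_all

lemma comm_lower_central_add_normal:
  assumes "x \<in> lower_central_add n" shows "comm x y \<in> lower_central_add n"
proof -
  have "comm x y = - x + (- y + x + y)"
    by (simp add: comm_def group_nf del: add_uminus_conv_diff)
  then show ?thesis
    using assms lower_central_add_closed lower_central_add_normal by metis
qed

lemma comm_lower_central_add_Suc:
  "x \<in> lower_central_add n \<Longrightarrow> comm x y \<in> lower_central_add (Suc n)"
  by (cases n) (auto intro: hull_base)

text \<open>
  The three subgroup argument in \<open>comm_lower_central_add\<close> rests on this identity of free groups.
\<close>

lemma hall_witt:
  fixes a b c :: "'a::group_add"
  shows "(- b + comm (comm a (- b)) c + b) + (- c + comm (comm b (- c)) a + c)
    + (- a + comm (comm c (- a)) b + a) = 0"
  by (simp add: comm_def group_nf del: add_uminus_conv_diff)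

text \<open>
  Induction on \<open>j\<close>: a generator \<open>[z, g]\<close> of the term \<open>j + 1\<close> is moved past \<open>x\<close> by the Hall-Witt identity, which
  expresses \<open>[[z, g], x]\<close> by \<open>[[g, x], z]\<close> and \<open>[[x, z], g]\<close>.
\<close>

lemma comm_lower_central_add:
  "x \<in> lower_central_add i \<Longrightarrow> y \<in> lower_central_add j \<Longrightarrow> comm x y \<in> lower_central_add (i + j)"
proof (induction j arbitrary: x y i rule: induct_nat_012)
  case (ge2 n)
  let ?L = "lower_central_add (i + Suc (Suc n))"
  show ?case
    using ge2(4) unfolding lower_central_add.simps
  proof (induction rule: subgroup_hull.induct)
    case hull_zero
    then show ?case using lower_central_add_closed(1) by (simp del: lower_central_add.simps add_Suc_right)
  next
    case (hull_base a)
    then obtain z g where a: "a = comm z g" and z: "z \<in> lower_central_add (Suc n)" by blast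
    have "comm (- g) (- x) \<in> lower_central_add (Suc i)"
      using comm_lower_central_add_Suc[of "- x" i "- g"] ge2(3) lower_central_add_closed minus_comm by metis
    then have 1: "comm (comm (- g) (- x)) z \<in> ?L"
      using ge2(2)[OF _ z, of "comm (- g) (- x)" "Suc i"] by simp
    have "comm x (- z) \<in> lower_central_add (i + Suc n)"
      by (rule ge2(2)[OF ge2(3) lower_central_add_closed(3)[OF z]])
    then have 2: "comm (comm x (- z)) (- g) \<in> ?L"
      using comm_lower_central_add_Suc[of "comm x (- z)" "i + Suc n" "- g"] by simp
    have "(- (- g) + comm (comm z (- (- g))) x + - g)
      = - ((- x + comm (comm (- g) (- x)) z + x) + (- z + comm (comm x (- z)) (- g) + z))"
      using hall_witt[of "- g" z x] by (simp only: add.assoc eq_neg_iff_add_eq_0)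
    also have "\<dots> \<in> ?L"
      using 1 2 lower_central_add_closed lower_central_add_normal by metis
    finally have "- g + (- (- g) + comm (comm z (- (- g))) x + - g) + g \<in> ?L"
      by (rule lower_central_add_normal)
    then have "comm a x \<in> ?L" by (simp add: a group_nf del: add_uminus_conv_diff)
    then show ?case using minus_comm[of a x] lower_central_add_closed by metis
  next
    case (hull_add a b)
    have "comm x (a + b) = comm x b + comm x a + comm (comm x a) b" by (rule comm_add_right)
    then show ?case
      using hull_add lower_central_add_closed comm_lower_central_add_normal by metis
  next
    case (hull_minus a)
    have "comm x (- a) = - (- (- a) + comm x a + - a)"
      by (simp add: comm_def group_nf del: add_uminus_conv_diff)
    then show ?case
      using hull_minus lower_central_add_closed lower_central_add_normal by metis
  qed
qed (use comm_lower_central_add_normal comm_lower_central_add_Suc in auto)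

lemma lower_central_add_Suc_subset: "lower_central_add (Suc n) \<subseteq> (lower_central_add n :: 'a::group_add set)"
proof (cases n)
  case (Suc m)
  have "x \<in> lower_central_add (Suc (Suc m)) \<Longrightarrow> x \<in> lower_central_add (Suc m)" for x :: 'a
    unfolding lower_central_add.simps(3)
    by (induction rule: subgroup_hull.induct)
      (auto intro: lower_central_add_closed comm_lower_central_add_normal)
  then show ?thesis using Suc by blast
qed simp

interpretation lower_central_add: group_series lower_central_add
proof
  show "lower_central_add (Suc k) \<subseteq> lower_central_add k" for k
    by (rule lower_central_add_Suc_subset)
  show "comm x y \<in> lower_central_add (i + j)"
    if "x \<in> lower_central_add i" "y \<in> lower_central_add j" for x y :: 'a and i j
    by (rule comm_lower_central_add[OF that])
qed (simp_all add: lower_central_add_closed)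

section \<open>Wreath products\<close>

definition translate :: "'b::ab_group_add \<Rightarrow> ('b \<Rightarrow> 'a) \<Rightarrow> 'b \<Rightarrow> 'a" where
  "translate t f = (\<lambda>x. f (x + t))"

lemma translate_add [simp]: "translate t (f + g) = translate t f + translate t g"
  and translate_minus [simp]: "translate t (- f) = - translate t f"
  and translate_diff [simp]: "translate t (f - g) = translate t f - translate t g"
  and translate_zero [simp]: "translate t 0 = 0" "translate 0 h = h"
  and translate_translate [simp]: "translate s (translate t h) = translate (s + t) h"
  for f g :: "'b::ab_group_add \<Rightarrow> 'a::group_add"
  by (auto simp: translate_def fun_eq_iff ac_simps)

text \<open>
  The unrestricted wreath product of \<open>'a\<close> by the abelian group \<open>'b\<close>: pairs of a map and a translation.
\<close>

datatype ('a, 'b) wreath = Wr (base: "'b \<Rightarrow> 'a") (shift: 'b)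

instantiation wreath :: (group_add, ab_group_add) group_add
begin

definition "0 = Wr 0 0"
definition "x + y = Wr (base x + translate (shift x) (base y)) (shift x + shift y)"
definition "- x = Wr (translate (- shift x) (- base x)) (- shift x)"
definition "x - y = x + - (y :: ('a, 'b) wreath)"

instance
  by standard (simp_all add: zero_wreath_def plus_wreath_def uminus_wreath_def minus_wreath_def
      add.assoc del: add_uminus_conv_diff)

end

lemma Wr_add [simp]: "Wr f s + Wr g t = Wr (f + translate s g) (s + t)"
  for f g :: "'b::ab_group_add \<Rightarrow> 'a::group_add"
  by (simp add: plus_wreath_def)

lemma Wr_minus [simp]: "- Wr f s = Wr (- translate (- s) f) (- s)"
  for f :: "'b::ab_group_add \<Rightarrow> 'a::group_add"
  by (simp add: uminus_wreath_def)

lemma Wr_diff [simp]: "Wr f s - Wr g t = Wr (f - translate (s - t) g) (s - t)"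
  for f g :: "'b::ab_group_add \<Rightarrow> 'a::group_add"
  by (simp add: minus_wreath_def)

lemma Wr_eq_zero [simp]: "Wr f s = 0 \<longleftrightarrow> f = 0 \<and> s = 0"
  for f :: "'b::ab_group_add \<Rightarrow> 'a::group_add"
  by (simp add: zero_wreath_def)

lemma comm_Wr:
  "comm (Wr f s) (Wr g t)
    = Wr (translate (- s - t) (- translate t f - g + f + translate s g)) 0"
  for f g :: "'b::ab_group_add \<Rightarrow> 'a::group_add"
  by (simp add: comm_def algebra_simps)

lemma comm_fun: "comm f g x = comm (f x) (g x)" for f g :: "'b \<Rightarrow> 'a::group_add"
  by (simp add: comm_def)

lemma translate_comm: "translate t (comm f g) = comm (translate t f) (translate t g)"
  for f g :: "'b::ab_group_add \<Rightarrow> 'a::group_add"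
  by (simp add: comm_def)

section \<open>Polynomial maps\<close>

text \<open>
  One step towards polynomial maps: the maps in \<open>P k\<close> all of whose first differences are in \<open>P (Suc k)\<close>.
\<close>

definition differences ::
  "(nat \<Rightarrow> ('b::ab_group_add \<Rightarrow> 'a::group_add) set) \<Rightarrow> nat \<Rightarrow> ('b \<Rightarrow> 'a) set" where
  "differences P k = {f \<in> P k. \<forall>t. - f + translate t f \<in> P (Suc k)}"

lemma mem_differences:
  "f \<in> differences P k \<longleftrightarrow> f \<in> P k \<and> (\<forall>t. - f + translate t f \<in> P (Suc k))"
  by (simp add: differences_def)

text \<open>
  The theorem of Lazard and Leibman, that polynomial maps form a group, in inductive form: the
  difference of \<open>[x, y]\<close> is the perturbation of \<open>[x, y]\<close> that replaces \<open>x\<close> by \<open>x + (- x + translate t x)\<close> and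
  likewise for \<open>y\<close>, so \<open>comm_perturb_mem\<close> for \<open>P\<close> itself applies.
\<close>

lemma strongly_central_differences:
  fixes P :: "nat \<Rightarrow> ('b::ab_group_add \<Rightarrow> 'a::group_add) set"
  assumes "strongly_central P"
  shows "strongly_central (differences P)"
proof -
  interpret strongly_central P by fact
  show ?thesis
  proof
    fix x y i j assume x: "x \<in> differences P i" and y: "y \<in> differences P j"
    have "- comm x y + comm (x + (- x + translate t x)) (y + (- y + translate t y)) \<in> P (Suc (i + j))" for t
      using x y by (intro comm_perturb_mem) (auto simp: differences_def)
    then show "comm x y \<in> differences P (i + j)"
      using x y comm_mem by (auto simp: differences_def translate_comm simp flip: add.assoc)
  next
    fix x y k assume x: "x \<in> differences P k" and y: "y \<in> differences P k"
    have "- (x + y) + translate t (x + y)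
      = (- y + (- x + translate t x) + y) + (- y + translate t y)" for t
      by (simp add: group_nf del: add_uminus_conv_diff)
    moreover have "(- y + (- x + translate t x) + y) + (- y + translate t y) \<in> P (Suc k)" for t
      using x y conj_mem[of "- x + translate t x" "Suc k" y k]
        add_mem[of "- y + (- x + translate t x) + y" "Suc k" "- y + translate t y"]
      by (simp add: mem_differences)
    ultimately show "x + y \<in> differences P k"
      using x y by (simp add: mem_differences add_mem del: translate_add)
  next
    fix x k assume x: "x \<in> differences P k"
    have "- (- x) + translate t (- x) = x + - (- x + translate t x) - x" for t
      by (simp add: group_nf del: add_uminus_conv_diff)
    moreover have "x + - (- x + translate t x) - x \<in> P (Suc k)" for t
      using x conj_mem'[OF minus_mem, of "- x + translate t x" "Suc k" x k]
      by (simp add: mem_differences del: minus_add)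
    ultimately show "- x \<in> differences P k"
      using x by (simp add: mem_differences minus_mem del: translate_minus)
  qed (use zero_mem Suc_subset in \<open>auto simp: differences_def\<close>)
qed

text \<open>
  Maps with values in \<open>F k\<close> whose differences of order \<open>d\<close> have values in \<open>F (k + d)\<close>, for all \<open>d\<close>.
\<close>

definition polynomial_maps ::
  "(nat \<Rightarrow> 'a::group_add set) \<Rightarrow> nat \<Rightarrow> ('b::ab_group_add \<Rightarrow> 'a) set" where
  "polynomial_maps F k = (\<Inter>d. (differences ^^ d) (\<lambda>k. {f. \<forall>x. f x \<in> F k}) k)"

lemma strongly_central_polynomial_maps:
  fixes F :: "nat \<Rightarrow> 'a::group_add set"
  assumes "strongly_central F"
  shows "strongly_central (polynomial_maps F :: nat \<Rightarrow> ('b::ab_group_add \<Rightarrow> 'a) set)"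
proof -
  interpret strongly_central F by fact
  have "strongly_central (\<lambda>k. {f :: 'b \<Rightarrow> 'a. \<forall>x. f x \<in> F k})"
    by standard (auto simp: comm_fun intro: zero_mem add_mem minus_mem comm_mem subsetD[OF Suc_subset])
  then have "strongly_central ((differences ^^ d) (\<lambda>k. {f :: 'b \<Rightarrow> 'a. \<forall>x. f x \<in> F k}))" for d
    by (induction d) (simp_all add: strongly_central_differences)
  then show ?thesis
    using strongly_central_Inter[of "\<lambda>d. (differences ^^ d) (\<lambda>k. {f :: 'b \<Rightarrow> 'a. \<forall>x. f x \<in> F k})"]
    by (simp add: polynomial_maps_def[abs_def])
qed

lemma polynomial_maps_value: "f \<in> polynomial_maps F k \<Longrightarrow> f x \<in> F k"
  by (auto simp: polynomial_maps_def dest: spec[of _ 0])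

lemma polynomial_maps_difference:
  assumes "f \<in> polynomial_maps F k" shows "- f + translate t f \<in> polynomial_maps F (Suc k)"
proof -
  have "f \<in> (differences ^^ Suc d) (\<lambda>k. {f. \<forall>x. f x \<in> F k}) k" for d
    using assms by (auto simp only: polynomial_maps_def)
  then show ?thesis by (auto simp: polynomial_maps_def differences_def)
qed

lemma polynomial_mapsI:
  assumes "\<And>x. f x \<in> F k" and D: "\<And>t. - f + translate t f \<in> polynomial_maps F (Suc k)"
  shows "f \<in> polynomial_maps F k"
proof -
  have "f \<in> (differences ^^ d) (\<lambda>k. {f. \<forall>x. f x \<in> F k}) k" for d
  proof (induction d)
    case (Suc d)
    then show ?case using D by (auto simp: polynomial_maps_def mem_differences)
  qed (use assms in simp)
  then show ?thesis by (auto simp: polynomial_maps_def)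
qed

lemma const_polynomial_maps:
  assumes "strongly_central F" "c \<in> F k"
  shows "(\<lambda>_. c) \<in> (polynomial_maps F k :: ('b::ab_group_add \<Rightarrow> _) set)"
proof (rule polynomial_mapsI)
  interpret P: strongly_central "polynomial_maps F :: nat \<Rightarrow> ('b \<Rightarrow> 'a) set"
    by (rule strongly_central_polynomial_maps) fact
  have "- (\<lambda>_. c) + translate t (\<lambda>_. c) = (0 :: 'b \<Rightarrow> 'a)" for t
    by (auto simp: fun_eq_iff translate_def)
  then show "- (\<lambda>_. c) + translate t (\<lambda>_. c) \<in> (polynomial_maps F (Suc k) :: ('b \<Rightarrow> 'a) set)" for t
    using P.zero_mem by simp
qed fact

lemma translate_polynomial_maps:
  assumes "strongly_central F" "f \<in> polynomial_maps F k"
  shows "translate t f \<in> polynomial_maps F k"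
proof -
  interpret P: strongly_central "polynomial_maps F :: nat \<Rightarrow> ('b \<Rightarrow> 'a) set"
    by (rule strongly_central_polynomial_maps) fact
  have "translate t f = f + (- f + translate t f)" by (simp flip: add.assoc)
  then show ?thesis
    using assms P.Suc_subset polynomial_maps_difference P.add_mem by (metis subsetD)
qed

text \<open>
  A translation has depth 1, since it moves a polynomial map of depth \<open>k\<close> by a difference, which has depth
  \<open>k + 1\<close>.
\<close>

definition wreath_series :: "(nat \<Rightarrow> 'a::group_add set) \<Rightarrow> nat \<Rightarrow> ('a, 'b::ab_group_add) wreath set" where
  "wreath_series F k = {x. base x \<in> polynomial_maps F k \<and> (k \<le> 1 \<or> shift x = 0)}"

lemma Wr_mem_wreath_series [simp]:
  "Wr f t \<in> wreath_series F k \<longleftrightarrow> f \<in> polynomial_maps F k \<and> (k \<le> 1 \<or> t = 0)"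
  by (simp add: wreath_series_def)

text \<open>
  A commutator of pairs is a commutator of maps, up to a difference of each of the two maps.
\<close>

lemma strongly_central_wreath_series:
  assumes "strongly_central F"
  shows "strongly_central (wreath_series F :: nat \<Rightarrow> ('a::group_add, 'b::ab_group_add) wreath set)"
proof -
  interpret P: strongly_central "polynomial_maps F :: nat \<Rightarrow> ('b \<Rightarrow> 'a) set"
    by (rule strongly_central_polynomial_maps) fact
  note tr = translate_polynomial_maps[OF assms]
  show ?thesis
  proof
    fix x y :: "('a, 'b) wreath" and i j
    assume "x \<in> wreath_series F i" "y \<in> wreath_series F j"
    then obtain f s g t where x: "x = Wr f s" "f \<in> polynomial_maps F i" "i \<le> 1 \<or> s = 0"
      and y: "y = Wr g t" "g \<in> polynomial_maps F j" "j \<le> 1 \<or> t = 0"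
      by (metis Wr_mem_wreath_series wreath.exhaust)
    have a: "- f + translate t f \<in> polynomial_maps F (i + j)"
    proof (cases "j \<le> 1")
      case True
      then show ?thesis using P.antimono[OF _ polynomial_maps_difference[OF x(2)], of "i + j"] by simp
    next
      case False
      then show ?thesis using y P.zero_mem by simp
    qed
    have b: "- g + translate s g \<in> polynomial_maps F (i + j)"
    proof (cases "i \<le> 1")
      case True
      then show ?thesis using P.antimono[OF _ polynomial_maps_difference[OF y(2)], of "i + j"] by simp
    next
      case False
      then show ?thesis using x P.zero_mem by simp
    qed
    have "- translate t f - g + f + translate s g
        = - (- f + translate t f) + comm f g + (- g + translate s g)"
      by (simp add: comm_def group_nf del: add_uminus_conv_diff)
    also have "\<dots> \<in> polynomial_maps F (i + j)"
      using P.add_mem[OF P.add_mem[OF P.minus_mem[OF a] P.comm_mem] b] x(2) y(2) .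
    finally show "comm x y \<in> wreath_series F (i + j)"
      using tr[of "- translate t f - g + f + translate s g" "i + j" "- s - t"] by (simp add: x y comm_Wr)
  next
    fix x y :: "('a, 'b) wreath" and k
    assume "x \<in> wreath_series F k" "y \<in> wreath_series F k"
    then show "x + y \<in> wreath_series F k"
      by (cases x; cases y) (auto intro: P.add_mem tr)
  next
    fix x :: "('a, 'b) wreath" and k
    assume "x \<in> wreath_series F k"
    then show "- x \<in> wreath_series F k"
      by (cases x) (auto intro: P.minus_mem tr)
  qed (use P.zero_mem P.Suc_subset in \<open>auto simp: wreath_series_def zero_wreath_def\<close>)
qed

definition diagonal :: "'a \<Rightarrow> ('a::group_add, 'b::ab_group_add) wreath" where
  "diagonal x = Wr (\<lambda>_. x) 0"

lemma diagonal_add: "diagonal (x + y) = diagonal x + diagonal y"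
  and diagonal_minus: "diagonal (- x) = - diagonal x"
  by (auto simp: diagonal_def translate_def fun_eq_iff)

lemma diagonal_zero [simp]: "diagonal 0 = 0"
  by (simp add: diagonal_def fun_eq_iff)

lemma diagonal_comm: "diagonal (comm x y) = comm (diagonal x) (diagonal y)"
  by (simp add: comm_def diagonal_add diagonal_minus flip: add_uminus_conv_diff)

lemma diagonal_mem_wreath_series:
  "strongly_central F \<Longrightarrow> diagonal x \<in> wreath_series F k \<longleftrightarrow> x \<in> F k"
  by (auto simp: diagonal_def const_polynomial_maps dest: polynomial_maps_value)

text \<open>
  The elements of a strongly central series that become commutators in the wreath product by \<open>\<int>\<close> are the
  values \<open>q 1\<close> of one-parameter subgroups \<open>q\<close>.  Commutation with the translation by \<open>- 1\<close> is the difference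
  operator, so that a depth of \<open>q\<close> one more gives a commutator, and two more a triple commutator.
\<close>

locale one_parameter = strongly_central F for F :: "nat \<Rightarrow> 'a::group_add set" +
  fixes q :: "int \<Rightarrow> 'a"
  assumes q_add: "q (m + n) = q m + q n"
begin

lemma q_zero: "q 0 = 0"
proof -
  have "q 0 + q 0 = q 0 + 0" by (simp flip: q_add)
  then show ?thesis by (rule add_left_imp_eq)
qed

lemma q_minus: "q (- m) = - q m"
  using q_add[of m "- m"] by (simp add: q_zero eq_neg_iff_add_eq_0 minus_unique)

lemma q_polynomial:
  assumes "\<And>n. q n \<in> F (Suc k)"
  shows "q \<in> polynomial_maps F k"
proof (rule polynomial_mapsI)
  have "- q + translate t q = (\<lambda>_. q t)" for t
    by (auto simp: fun_eq_iff translate_def q_add)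
  then show "- q + translate t q \<in> polynomial_maps F (Suc k)" for t
    by (simp add: const_polynomial_maps[OF strongly_central_axioms assms])
qed (use assms Suc_subset in blast)

lemma q_binomial_polynomial:
  assumes "\<And>n. q n \<in> F (Suc (Suc k))"
  shows "(\<lambda>n. q (n * (n - 1) div 2)) \<in> polynomial_maps F k"
proof (rule polynomial_mapsI)
  interpret P: strongly_central "polynomial_maps F :: nat \<Rightarrow> (int \<Rightarrow> 'a) set"
    by (rule strongly_central_polynomial_maps) standard
  let ?f = "\<lambda>n. q (n * (n - 1) div 2)"
  fix t
  have "(n + t) * (n + t - 1) div 2 = n * (n - 1) div 2 + (n * t + t * (t - 1) div 2)" for n :: int
  proof -
    have "(n + t) * (n + t - 1) = n * (n - 1) + t * (t - 1) + 2 * (n * t)"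
      by (simp add: algebra_simps)
    moreover have "2 * (a * (a - 1) div 2) = a * (a - 1)" for a :: int
      by (rule dvd_mult_div_cancel) simp
    note this[of n] this[of t] this[of "n + t"]
    ultimately show ?thesis by linarith
  qed
  then have "- ?f + translate t ?f = (\<lambda>n. q (n * t)) + (\<lambda>_. q (t * (t - 1) div 2))"
    by (auto simp: fun_eq_iff translate_def q_add add.assoc)
  moreover have "(\<lambda>n. q (n * t)) \<in> polynomial_maps F (Suc k)"
  proof -
    interpret qt: one_parameter F "\<lambda>n. q (n * t)"
      by standard (simp add: distrib_right q_add)
    show ?thesis using assms by (intro qt.q_polynomial)
  qed
  moreover have "(\<lambda>_. q (t * (t - 1) div 2)) \<in> (polynomial_maps F (Suc k) :: (int \<Rightarrow> 'a) set)"
    using assms Suc_subset by (intro const_polynomial_maps strongly_central_axioms) blast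
  ultimately show "- ?f + translate t ?f \<in> polynomial_maps F (Suc k)"
    using P.add_mem by simp
qed (use assms Suc_subset in blast)

lemma comm_q: "comm (Wr q 0) (Wr 0 (- 1)) = diagonal (q 1)"
  by (auto simp: comm_Wr diagonal_def fun_eq_iff translate_def simp flip: q_minus q_add)

lemma comm_q_binomial: "comm (Wr (\<lambda>n. q (n * (n - 1) div 2)) 0) (Wr 0 (- 1)) = Wr q 0"
proof -
  have "- (x * (x - 1) div 2) + (x + 1) * x div 2 = x" for x :: int
  proof -
    have "(x + 1) * x = x * (x - 1) + 2 * x" by (simp add: algebra_simps)
    then show ?thesis by simp
  qed
  then show ?thesis
    by (auto simp: comm_Wr fun_eq_iff translate_def simp flip: q_minus q_add)
qed

end

section \<open>Groups of class three from trilinear forms\<close>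

text \<open>
  The subgroups \<open>M k\<close> filter the abelian group by weight; from weight 4 on they lie in the radical of \<open>S\<close>
  modulo \<open>N\<close>.  By truncated subtraction, \<open>s\<close> in \<open>weight\<close> ranges over everything if \<open>i + j \<ge> 7\<close>.
\<close>

locale cubic_tensor =
  fixes S :: "'m::ab_group_add \<Rightarrow> 'm \<Rightarrow> 'm \<Rightarrow> int" and N :: int and M :: "nat \<Rightarrow> 'm set"
  assumes add1: "S (p + q) x y = S p x y + S q x y"
    and add2: "S p (x + x') y = S p x y + S p x' y"
    and sym: "S p x y = S p y x"
    and zero_M: "0 \<in> M k" and add_M: "m \<in> M k \<Longrightarrow> n \<in> M k \<Longrightarrow> m + n \<in> M k"
    and minus_M: "m \<in> M k \<Longrightarrow> - m \<in> M k"
    and Suc_M: "M (Suc k) \<subseteq> M k"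
    and M_0: "M 0 = UNIV"
    and radical: "k \<ge> 4 \<Longrightarrow> r \<in> M k \<Longrightarrow> N dvd S r x y \<and> N dvd S x r y"
    and weight: "p \<in> M i \<Longrightarrow> q \<in> M j \<Longrightarrow> s \<in> M (7 - (i + j)) \<Longrightarrow> N dvd 2 * (S p q s - S q p s)"
begin

lemma add3: "S p x (y + y') = S p x y + S p x y'"
  by (metis add2 sym)

lemma radical3: "k \<ge> 4 \<Longrightarrow> r \<in> M k \<Longrightarrow> N dvd S x y r"
  using radical sym by metis

lemma S_zero [simp]: "S 0 x y = 0" "S p 0 y = 0" "S p x 0 = 0"
  using add1[of 0 0] add2[of _ 0 0] add3[of _ _ 0 0] by simp_all

lemma S_minus [simp]: "S (- p) x y = - S p x y" "S p (- x) y = - S p x y" "S p x (- y) = - S p x y"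
  using add1[of p "- p" x y] add2[of p x "- x" y] add3[of p x y "- y"] by simp_all

lemma S_diff: "S (p - q) x y = S p x y - S q x y" "S p (x - x') y = S p x y - S p x' y"
  "S p x (y - y') = S p x y - S p x y'"
  using add1[of p "- q"] add2[of _ x "- x'"] add3[of _ _ y "- y'"] by simp_all

lemmas S_simps = add1 add2 add3 S_diff

lemma M_antimono: "i \<le> j \<Longrightarrow> m \<in> M j \<Longrightarrow> m \<in> M i"
  using lift_Suc_antimono_le[of M i j] Suc_M by blast

text \<open>
  The base of an element over \<open>m\<close> is the quadratic map \<open>z \<mapsto> S m z z\<close> up to an affine map \<open>z \<mapsto> l z + c\<close>.  The linear
  part has weight at least \<open>k\<close> if it vanishes on \<open>M (7 - k)\<close>, and constants have weight 6.  The
  quadratic part is tied to \<open>m\<close> instead of being given a weight of its own: only its antisymmetrisation,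
  which enters the commutators, satisfies the weight condition, and a series that treats the
  quadratic maps independently would force \<open>S\<close> itself to satisfy it.
\<close>

definition series :: "nat \<Rightarrow> (int, 'm) wreath set" where
  "series k = {x. shift x \<in> M k \<and> (\<exists>l c. additive l \<and> base x = (\<lambda>z. S (shift x) z z + l z + c)
     \<and> (\<forall>z\<in>M (7 - k). N dvd l z) \<and> (k \<ge> 7 \<longrightarrow> N dvd c))}"

lemma seriesI:
  assumes "m \<in> M k" "additive l" "\<And>z. f z = S m z z + l z + c"
    "\<And>z. z \<in> M (7 - k) \<Longrightarrow> N dvd l z" "k \<ge> 7 \<Longrightarrow> N dvd c"
  shows "Wr f m \<in> series k"
  unfolding series_def using assms by (auto intro!: exI[of _ l] exI[of _ c])

lemma seriesE:
  assumes "x \<in> series k"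
  obtains m l c where "x = Wr (\<lambda>z. S m z z + l z + c) m" "m \<in> M k" "additive l"
    "\<forall>z\<in>M (7 - k). N dvd l z" "k \<ge> 7 \<longrightarrow> N dvd c"
  using assms by (cases x) (auto simp: series_def)

text \<open>
  The commutator of elements over \<open>m\<close> and \<open>m'\<close> is the affine map with linear part
  \<open>2 (S m' m z - S m m' z)\<close>, which vanishes on the right subgroup by \<open>weight\<close>.  All other terms that occur
  contain an argument from the radical or a linear part evaluated at a place where it vanishes.
\<close>

lemma strongly_central_series: "strongly_central series"
proof
  fix k
  show "0 \<in> series k"
    unfolding zero_wreath_def by (rule seriesI[where l = "\<lambda>_. 0" and c = 0]) (auto simp: zero_M additive_def)
  show "series (Suc k) \<subseteq> series k"
  proof
    fix x assume "x \<in> series (Suc k)"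
    then obtain m l c where x: "x = Wr (\<lambda>z. S m z z + l z + c) m" "m \<in> M (Suc k)" "additive l"
      "\<forall>z\<in>M (7 - Suc k). N dvd l z" "Suc k \<ge> 7 \<longrightarrow> N dvd c"
      by (rule seriesE) (rule that)
    have "z \<in> M (7 - k) \<Longrightarrow> z \<in> M (7 - Suc k)" for z
      by (rule M_antimono[of "7 - Suc k" "7 - k"]) auto
    then show "x \<in> series k"
      unfolding x(1) using x(2-) by (intro seriesI[where l = l and c = c]) (auto intro: M_antimono[of k "Suc k"])
  qed
next
  fix x y k assume "x \<in> series k" and *: "y \<in> series k"
  then obtain m l c where
    x: "x = Wr (\<lambda>z. S m z z + l z + c) m" "m \<in> M k" "additive l"
      "\<forall>z\<in>M (7 - k). N dvd l z" "k \<ge> 7 \<longrightarrow> N dvd c"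
    by (elim seriesE) (rule that)
  from * obtain m' l' c' where
    y: "y = Wr (\<lambda>z. S m' z z + l' z + c') m'" "m' \<in> M k" "additive l'"
      "\<forall>z\<in>M (7 - k). N dvd l' z" "k \<ge> 7 \<longrightarrow> N dvd c'"
    by (rule seriesE) (rule that)
  interpret l: additive l by fact
  interpret l': additive l' by fact
  have "N dvd S m' m z" if "z \<in> M (7 - k)" for z
    using radical[of k m] radical3[of "7 - k" z] that x(2) by (cases "k \<ge> 4") auto
  moreover have "N dvd S m' m m" if "k \<ge> 7"
    using radical[of k m] that x(2) by auto
  moreover have "S m z z + l z + c + (S m' (z + m) (z + m) + l' (z + m) + c')
      = S (m + m') z z + (l z + l' z + 2 * S m' m z) + (c + c' + l' m + S m' m m)" for z
    by (simp add: l'.add add1 add2 add3 sym[of m' z m])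
  ultimately show "x + y \<in> series k"
    unfolding x(1) y(1) Wr_add using x(2-) y(2-)
    by (intro seriesI[where l = "\<lambda>z. l z + l' z + 2 * S m' m z" and c = "c + c' + l' m + S m' m m"])
      (auto simp: add_M additive_def l.add l'.add translate_def add3 M_0)
next
  fix x k assume "x \<in> series k"
  then obtain m l c where
    x: "x = Wr (\<lambda>z. S m z z + l z + c) m" "m \<in> M k" "additive l"
      "\<forall>z\<in>M (7 - k). N dvd l z" "k \<ge> 7 \<longrightarrow> N dvd c"
    by (rule seriesE) (rule that)
  interpret l: additive l by fact
  have "N dvd S m m z" if "z \<in> M (7 - k)" for z
    using radical[of k m] radical3[of "7 - k" z] that x(2) by (cases "k \<ge> 4") auto
  moreover have "N dvd S m m m" if "k \<ge> 7"
    using radical[of k m] that x(2) by auto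
  moreover have "- (S m (z + - m) (z + - m) + l (z + - m) + c)
      = S (- m) z z + (2 * S m m z - l z) + (l m - c - S m m m)" for z
    by (simp add: l.diff S_diff sym[of m z m])
  ultimately show "- x \<in> series k"
    unfolding x(1) Wr_minus using x(2-)
    by (intro seriesI[where l = "\<lambda>z. 2 * S m m z - l z" and c = "l m - c - S m m m"])
      (auto simp: minus_M additive_def l.add translate_def add3 M_0)
next
  fix x y i j assume "x \<in> series i" and *: "y \<in> series j"
  then obtain m l c where
    x: "x = Wr (\<lambda>z. S m z z + l z + c) m" "m \<in> M i" "additive l"
      "\<forall>z\<in>M (7 - i). N dvd l z" "i \<ge> 7 \<longrightarrow> N dvd c"
    by (elim seriesE) (rule that)
  from * obtain m' l' c' where
    y: "y = Wr (\<lambda>z. S m' z z + l' z + c') m'" "m' \<in> M j" "additive l'"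
      "\<forall>z\<in>M (7 - j). N dvd l' z" "j \<ge> 7 \<longrightarrow> N dvd c'"
    by (rule seriesE) (rule that)
  interpret l: additive l by fact
  interpret l': additive l' by fact
  show "comm x y \<in> series (i + j)"
    unfolding x(1) y(1) comm_Wr
  proof (rule seriesI[where l = "\<lambda>z. 2 * (S m' m z - S m m' z)"
        and c = "l' m - l m' - S m' m m + S m m' m' + 2 * S m m' m - 2 * S m' m m'"])
    fix z assume "z \<in> M (7 - (i + j))"
    then show "N dvd 2 * (S m' m z - S m m' z)"
      using weight[OF y(2) x(2)] by (simp add: add.commute)
  next
    assume k: "7 \<le> i + j"
    have "m \<in> M (7 - j)" "m' \<in> M (7 - i)"
      using k M_antimono[OF _ x(2)] M_antimono[OF _ y(2)] by auto
    moreover have "4 \<le> i \<or> 4 \<le> j" using k by auto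
    then have "N dvd S m' m z \<and> N dvd S m m' z" for z
      using radical[OF _ x(2)] radical[OF _ y(2)] by blast
    ultimately show "N dvd l' m - l m' - S m' m m + S m m' m' + 2 * S m m' m - 2 * S m' m m'"
      using x y by (intro dvd_add dvd_diff dvd_mult) auto
  next
    fix z
    let ?f = "\<lambda>z. S m z z + l z + c" and ?g = "\<lambda>z. S m' z z + l' z + c'"
    \<comment> \<open>The commutator is a difference of increments, translated back by \<open>m + m'\<close>.\<close>
    define w where "w = z + (- m - m')"
    have "- ?f (w + m') - ?g w + ?f w + ?g (w + m)
        = 2 * (S m' m w - S m m' w) + (l' m - l m' + S m' m m - S m m' m')"
      by (simp add: add2 add3 l.add l'.add sym[of _ w m] sym[of _ w m'])
    also have "\<dots> = 2 * (S m' m z - S m m' z)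
        + (l' m - l m' - S m' m m + S m m' m' + 2 * S m m' m - 2 * S m' m m')"
      by (simp add: w_def add3 S_diff)
    finally show "translate (- m - m') (- translate m' ?f - ?g + ?f + translate m ?g) z
        = S 0 z z + 2 * (S m' m z - S m m' z)
        + (l' m - l m' - S m' m m + S m m' m' + 2 * S m m' m - 2 * S m' m m')"
      by (simp add: translate_def w_def add.assoc)
  qed (auto simp: zero_M additive_def add3)
qed

definition lift :: "'m \<Rightarrow> (int, 'm) wreath" where
  "lift m = Wr (\<lambda>z. S m z z) m"

lemma lift_zero [simp]: "lift 0 = 0"
  by (simp add: lift_def zero_wreath_def fun_eq_iff)

lemma lift_mem_series: "m \<in> M k \<Longrightarrow> lift m \<in> series k"
  unfolding lift_def by (rule seriesI[where l = "\<lambda>_. 0" and c = 0]) (auto simp: additive_def)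

lemma lift_add: "(\<And>z. S n m z = 0) \<Longrightarrow> lift (m + n) = lift m + lift n"
  by (auto simp: lift_def fun_eq_iff translate_def S_simps sym)

lemma lift_add_cong:
  assumes "\<And>z. N dvd S n m z"
  shows "lift m + lift n - lift (m + n) \<in> series 7"
proof -
  have "lift m + lift n - lift (m + n) = Wr (\<lambda>z. 2 * S n m z + S n m m) 0"
    by (auto simp: lift_def fun_eq_iff translate_def S_simps sym)
  moreover have "Wr (\<lambda>z. 2 * S n m z + S n m m) 0 \<in> series 7"
    using assms by (intro seriesI[where l = "\<lambda>z. 2 * S n m z" and c = "S n m m"])
      (auto simp: zero_M additive_def S_simps)
  ultimately show ?thesis by simp
qed

lemma triple_comm_lift:
  "comm (comm (lift p) (lift q)) (lift s) = Wr (\<lambda>_. 2 * (S p q s - S q p s)) 0"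
proof -
  have *: "comm (lift p) (lift q) = Wr (\<lambda>z. 2 * (S q p (z + (- p - q)) - S p q (z + (- p - q))) + S q p p - S p q q) 0"
  proof -
    have "- S p (w + q) (w + q) - S q w w + S p w w + S q (w + p) (w + p)
      = 2 * (S q p w - S p q w) + S q p p - S p q q" for w
      by (simp add: add2 add3 sym[of _ w p] sym[of _ w q])
    from this[of "_ + (- p - q)"] show ?thesis
      by (simp add: lift_def comm_Wr translate_def fun_eq_iff)
  qed
  show ?thesis
    unfolding * by (simp add: lift_def comm_Wr translate_def fun_eq_iff add3 S_diff)
qed

lemma const_not_mem_series: 
  assumes "Wr (\<lambda>_. c) 0 \<in> series 7" shows "N dvd c"
proof -
  from assms obtain m l d where *: "Wr (\<lambda>_. c) 0 = Wr (\<lambda>z. S m z z + l z + d) m" "additive l"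
    and d: "(7::nat) \<ge> 7 \<longrightarrow> N dvd d" by (rule seriesE) (rule that)
  have "(\<lambda>_. c) = (\<lambda>z. S m z z + l z + d)" using *(1) by (rule wreath.inject[THEN iffD1, THEN conjunct1])
  from fun_cong[OF this, of 0] have "c = l 0 + d" by (simp only: S_zero add_0)
  then show ?thesis using d additive.zero[OF *(2)] by simp
qed

end

section \<open>The tensor\<close>

text \<open>
  Vectors are maps on the natural numbers of which the entries below 7 matter.  The indices 0 to 3 stand
  for \<open>e\<^sub>0, \<dots>, e\<^sub>3\<close>, and 4, 5, 6 for \<open>y\<^sub>0\<^sub>2, y\<^sub>1\<^sub>3, y\<^sub>2\<^sub>3\<close>; the index 7 serves as the null vector \<open>y\<^sub>0\<^sub>1\<close>.
\<close>

definition modulus :: int where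
  "modulus = 3 ^ 14"

text \<open>
  The entry at \<open>(i, j, k)\<close>, where \<open>j \<le> k\<close>, is \<open>T(i; j, k)\<close>.  The entries are a solution modulo \<open>3^14\<close> of the linear
  conditions in \<open>scale_dvd\<close>, \<open>coefficient_diagonal\<close> and \<open>relators_null\<close>.
  
  The source of the nonzero value is visible on the vectors \<open>f\<^sub>i = 9\<^sup>i e\<^sub>i\<close> of weight 2.  For
  \<open>\<phi>(p, q, s) = T(p; q, s) - T(q; p, s)\<close> the three values \<open>\<phi>(f\<^sub>0, f\<^sub>1, f\<^sub>2)\<close>, \<open>\<phi>(f\<^sub>1, f\<^sub>2, f\<^sub>0)\<close>, \<open>\<phi>(f\<^sub>2, f\<^sub>0, f\<^sub>1)\<close>
  are \<open>-2, 1, 1\<close> times \<open>3^10\<close>.  Their sum is zero, as the Jacobi identity demands, and in units of \<open>3^10\<close> they agree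
  modulo 3, which is forced by \<open>scale_dvd\<close> and \<open>relators_null\<close>.  Three equal values can add up to zero only
  modulo 3: this is the origin of the 3-torsion.
\<close>

definition tensor_table :: "((nat \<times> nat \<times> nat) \<times> int) list" where
  "tensor_table =
    [((0,1,2), - (3^4)), ((1,0,2), 3^4),
     ((0,1,3), 3^3), ((1,0,3), - (3^3)),
     ((0,2,3), 3^2), ((3,0,2), - (3^2)),
     ((1,2,3), - 3), ((3,1,2), 3),
     ((0,3,3), - 3), ((1,3,3), 1), ((1,2,2), 3^2), ((3,2,2), 1),
     ((4,2,3), 3^4), ((4,3,3), - (3^3)),
     ((1,3,4), 3^5), ((3,1,4), 3^5), ((4,1,3), 3^5),
     ((1,2,5), - (3^8)), ((5,1,2), 3^8), ((5,0,3), - (3^8)), ((1,3,5), 3^7),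
     ((3,2,5), 3^6), ((5,2,3), - (3^6)), ((5,2,2), 2 * 3^7), ((5,3,3), 3^5),
     ((0,2,6), 3^10), ((6,0,2), - (3^10)), ((3,0,6), - (3^9)), ((6,1,2), 3^9),
     ((3,1,6), 3^8), ((3,2,6), 3^7), ((6,2,2), 3^8)]"

definition coefficient :: "nat \<Rightarrow> nat \<Rightarrow> nat \<Rightarrow> int" where
  "coefficient i j k = (case map_of tensor_table (i, min j k, max j k) of None \<Rightarrow> 0 | Some c \<Rightarrow> c)"

lemma coefficient_sym: "coefficient i j k = coefficient i k j"
  by (simp add: coefficient_def min.commute max.commute)

definition tensor :: "(nat \<Rightarrow> int) \<Rightarrow> (nat \<Rightarrow> int) \<Rightarrow> (nat \<Rightarrow> int) \<Rightarrow> int" where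
  "tensor p x y = (\<Sum>i<7. \<Sum>j<7. \<Sum>k<7. coefficient i j k * (p i * x j * y k))"

text \<open>
  The lattice of weight 2 is spanned by the \<open>9\<^sup>i e\<^sub>i\<close> and the \<open>y\<^sub>i\<^sub>j\<close>, that of weight 3 by the \<open>y\<^sub>i\<^sub>j\<close>, in both cases
  together with the null vectors.  A scale of 0 forces an entry to vanish.
\<close>

definition scale :: "nat \<Rightarrow> nat \<Rightarrow> int" where
  "scale k i = (if k \<le> 1 then 1 else if k = 2 then (if i < 4 then 9 ^ i else 1)
     else if k = 3 then (if i < 4 then 0 else 1) else 0)"

definition null_vectors :: "(nat \<Rightarrow> int) set" where
  "null_vectors = {r. \<forall>j<7. \<forall>k<7. modulus dvd (\<Sum>i<7. coefficient i j k * r i)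
     \<and> modulus dvd (\<Sum>i<7. coefficient j i k * r i)}"

definition lattice :: "nat \<Rightarrow> (nat \<Rightarrow> int) set" where
  "lattice k = {m + r | m r. (\<forall>i<7. scale k i dvd m i) \<and> r \<in> null_vectors}"

lemma null_vectors_closed:
  "0 \<in> null_vectors"
  "r \<in> null_vectors \<Longrightarrow> s \<in> null_vectors \<Longrightarrow> r + s \<in> null_vectors"
  "r \<in> null_vectors \<Longrightarrow> - r \<in> null_vectors"
  by (auto simp: null_vectors_def distrib_left sum.distrib sum_negf)

lemma tensor_null:
  assumes "r \<in> null_vectors"
  shows "modulus dvd tensor r x y" "modulus dvd tensor x r y"
proof -
  have "tensor r x y = (\<Sum>j<7. \<Sum>k<7. (\<Sum>i<7. coefficient i j k * r i) * (x j * y k))"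
    unfolding tensor_def
    by (subst sum.swap, rule sum.cong[OF refl], subst sum.swap) (simp add: sum_distrib_right mult.assoc)
  also have "modulus dvd \<dots>"
    by (rule dvd_sum, rule dvd_sum, rule dvd_mult2) (use assms in \<open>auto simp: null_vectors_def\<close>)
  finally show "modulus dvd tensor r x y" .
  have "tensor x r y = (\<Sum>j<7. \<Sum>k<7. (\<Sum>i<7. coefficient j i k * r i) * (x j * y k))"
    unfolding tensor_def
    by (rule sum.cong[OF refl], subst sum.swap) (simp add: sum_distrib_left sum_distrib_right ac_simps)
  also have "modulus dvd \<dots>"
    by (rule dvd_sum, rule dvd_sum, rule dvd_mult2) (use assms in \<open>auto simp: null_vectors_def\<close>)
  finally show "modulus dvd tensor x r y" .
qed

text \<open>
  By trilinearity the weight condition is a finite check on scaled basis vectors.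
\<close>

lemma weight_check:
  "list_all (\<lambda>i. list_all (\<lambda>j. list_all (\<lambda>a. list_all (\<lambda>b. list_all (\<lambda>c.
      modulus dvd 2 * (coefficient a b c - coefficient b a c) * (scale i a * scale j b * scale (7 - (i + j)) c))
    [0..<7]) [0..<7]) [0..<7]) [1, 2, 3]) [1, 2, 3]"
  by code_simp

lemma tensor_add:
  "tensor (p + q) x y = tensor p x y + tensor q x y"
  "tensor p (x + x') y = tensor p x y + tensor p x' y"
  "tensor p x (y + y') = tensor p x y + tensor p x y'"
  by (simp_all add: tensor_def distrib_left distrib_right sum.distrib)

lemma tensor_sym: "tensor p x y = tensor p y x"
  unfolding tensor_def
  by (rule sum.cong[OF refl], subst sum.swap) (simp add: coefficient_sym ac_simps)

lemma scale_dvd: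
  assumes "a < 7" "b < 7" "c < 7"
  shows "modulus dvd 2 * (coefficient a b c - coefficient b a c)
    * (scale i a * scale j b * scale (7 - (i + j)) c)"
proof -
  consider "i \<in> {1, 2, 3}" "j \<in> {1, 2, 3}" | "i \<ge> 4" | "j \<ge> 4" | "i = 0" "j \<le> 3" | "j = 0" "i \<le> 3"
    by force
  then show ?thesis
  proof cases
    case 1
    then show ?thesis using weight_check assms by (auto simp: list_all_iff)
  qed (auto simp: scale_def)
qed

lemma tensor_weight:
  assumes "p \<in> lattice i" "q \<in> lattice j" "s \<in> lattice (7 - (i + j))"
  shows "modulus dvd 2 * (tensor p q s - tensor q p s)"
proof -
  obtain p' r where p: "p = p' + r" "\<And>a. a < 7 \<Longrightarrow> scale i a dvd p' a" "r \<in> null_vectors"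
    using assms(1) by (auto simp: lattice_def)
  obtain q' r' where q: "q = q' + r'" "\<And>a. a < 7 \<Longrightarrow> scale j a dvd q' a" "r' \<in> null_vectors"
    using assms(2) by (auto simp: lattice_def)
  obtain s' r'' where s: "s = s' + r''" "\<And>a. a < 7 \<Longrightarrow> scale (7 - (i + j)) a dvd s' a" "r'' \<in> null_vectors"
    using assms(3) by (auto simp: lattice_def)
  have "tensor q' p' s' = (\<Sum>a<7. \<Sum>b<7. \<Sum>c<7. coefficient b a c * (p' a * q' b * s' c))"
    unfolding tensor_def by (subst sum.swap) (simp add: ac_simps)
  then have "2 * (tensor p' q' s' - tensor q' p' s') = (\<Sum>a<7. \<Sum>b<7. \<Sum>c<7.
      2 * (coefficient a b c - coefficient b a c) * (p' a * q' b * s' c))"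
    by (simp add: tensor_def sum_subtractf[symmetric] sum_distrib_left algebra_simps)
  also have "modulus dvd \<dots>"
  proof (rule dvd_sum, rule dvd_sum, rule dvd_sum)
    fix a b c :: nat assume "a \<in> {..<7}" "b \<in> {..<7}" "c \<in> {..<7}"
    then have abc: "a < 7" "b < 7" "c < 7" by auto
    show "modulus dvd 2 * (coefficient a b c - coefficient b a c) * (p' a * q' b * s' c)"
      by (rule dvd_trans[OF scale_dvd[OF abc, of i j]])
        (intro mult_dvd_mono dvd_refl p(2) q(2) s(2) abc)
  qed
  finally have main: "modulus dvd 2 * (tensor p' q' s' - tensor q' p' s')" .
  have "tensor p q s - tensor q p s = (tensor p' q' s' - tensor q' p' s')
      + (tensor p' q' r'' - tensor q' p' r'')
      + (tensor p' r' s - tensor r' p' s) + (tensor r q s - tensor q r s)"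
    by (simp add: p q s tensor_add)
  moreover have "modulus dvd tensor u v r''" for u v
    using tensor_null(2)[OF s(3)] by (simp add: tensor_sym[of u v r''])
  ultimately show ?thesis
    using main tensor_null[OF p(3)] tensor_null[OF q(3)]
    by (simp only: distrib_left dvd_add dvd_diff dvd_mult)
qed

interpretation cubic_tensor tensor modulus lattice
proof
  fix k :: nat and m n :: "nat \<Rightarrow> int"
  show "0 \<in> lattice k"
    unfolding lattice_def using null_vectors_closed(1)
    by (intro CollectI exI[of _ 0] exI[of _ "0 :: nat \<Rightarrow> int"]) auto
  show "m \<in> lattice k \<Longrightarrow> - m \<in> lattice k"
  proof -
    assume "m \<in> lattice k"
    then obtain a r where "m = a + r" "\<forall>i<7. scale k i dvd a i" "r \<in> null_vectors" by (auto simp: lattice_def)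
    then show ?thesis unfolding lattice_def using null_vectors_closed(3)
      by (intro CollectI exI[of _ "- a"] exI[of _ "- r"]) auto
  qed
  show "m + n \<in> lattice k" if mn: "m \<in> lattice k" "n \<in> lattice k"
  proof -
    obtain a r where "m = a + r" "\<forall>i<7. scale k i dvd a i" "r \<in> null_vectors"
      using mn(1) unfolding lattice_def by blast
    moreover obtain b s where "n = b + s" "\<forall>i<7. scale k i dvd b i" "s \<in> null_vectors"
      using mn(2) unfolding lattice_def by blast
    ultimately show ?thesis unfolding lattice_def using null_vectors_closed(2)
      by (intro CollectI exI[of _ "a + b"] exI[of _ "r + s"]) (auto simp: ac_simps)
  qed
  have "scale k i dvd scale (Suc k) i" for i by (auto simp: scale_def)
  then show "lattice (Suc k) \<subseteq> lattice k"
    unfolding lattice_def by (blast intro: dvd_trans)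
  show "lattice 0 = UNIV"
    using null_vectors_closed(1) by (force simp: lattice_def scale_def)
  fix r x y assume k: "4 \<le> k" and "r \<in> lattice k"
  then obtain a r' where r: "r = a + r'" "\<And>i. i < 7 \<Longrightarrow> a i = 0" "r' \<in> null_vectors"
    by (auto simp: lattice_def scale_def)
  moreover have "a \<in> null_vectors" using r(2) by (simp add: null_vectors_def)
  ultimately have "r \<in> null_vectors" by (simp add: null_vectors_closed)
  then show "modulus dvd tensor r x y \<and> modulus dvd tensor x r y"
    using tensor_null by blast
qed (fact tensor_add tensor_sym tensor_weight)+

definition axis :: "nat \<Rightarrow> int \<Rightarrow> nat \<Rightarrow> int" where
  "axis i n = (\<lambda>j. if j = i then n else 0)"

lemma axis_add: "axis i (m + n) = axis i m + axis i n"
  by (auto simp: axis_def)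

lemma tensor_axis:
  "tensor (axis i m) (axis j n) y
    = (if i < 7 \<and> j < 7 then m * n * (\<Sum>k<7. coefficient i j k * y k) else 0)"
proof -
  let ?c = "\<lambda>a b. \<Sum>k<7. coefficient a b k * (m * n * y k)"
  have "tensor (axis i m) (axis j n) y
      = (\<Sum>a<7. if a = i then (\<Sum>b<7. if b = j then ?c a b else 0) else 0)"
  proof -
    have "(\<Sum>k<7. coefficient a b k * (axis i m a * axis j n b * y k))
        = (if a = i then if b = j then ?c a b else 0 else 0)" for a b
      by (simp add: axis_def)
    moreover have "(\<Sum>b<7. if a = i then if b = j then ?c a b else 0 else 0)
        = (if a = i then (\<Sum>b<7. if b = j then ?c a b else 0) else 0)" for a
      by simp
    ultimately show ?thesis by (simp only: tensor_def)
  qed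
  also have "\<dots> = (if i < 7 \<and> j < 7 then ?c i j else 0)"
    by (simp add: sum.delta)
  finally show ?thesis by (simp add: sum_distrib_left ac_simps)
qed

lemma axis_mem_lattice: "(i < 7 \<Longrightarrow> scale k i dvd n) \<Longrightarrow> axis i n \<in> lattice k"
  unfolding lattice_def using null_vectors_closed(1)
  by (intro CollectI exI[of _ "axis i n"] exI[of _ "0 :: nat \<Rightarrow> int"]) (auto simp: axis_def)

text \<open>
  These coefficients vanish so that the multiples of a basis vector lift to a one-parameter subgroup.
\<close>

lemma coefficient_diagonal: "i < 7 \<Longrightarrow> k < 7 \<Longrightarrow> coefficient i i k = 0"
proof -
  have "list_all (\<lambda>i. list_all (\<lambda>k. coefficient i i k = 0) [0..<7]) [0..<7]" by code_simp
  then show "i < 7 \<Longrightarrow> k < 7 \<Longrightarrow> coefficient i i k = 0" by (simp add: list_all_iff)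
qed

lemma lift_axis_add: "lift (axis i (m + n)) = lift (axis i m) + lift (axis i n)"
  unfolding axis_add by (rule lift_add) (simp add: tensor_axis coefficient_diagonal)

lemma relators_null:
  "\<forall>(i, j, y) \<in> {(0, 1, 7), (0, 2, 4), (1, 3, 5), (2, 3, 6)}.
    axis j (3 ^ (12 - i)) + axis i (3 ^ (12 - j)) - axis y (3 ^ (12 - 2 * i - 2 * j)) \<in> null_vectors"
proof -
  have "list_all (\<lambda>(i, j, y). list_all (\<lambda>b. list_all (\<lambda>c.
      modulus dvd (\<Sum>a\<leftarrow>[0..<7]. coefficient a b c * (axis j (3 ^ (12 - i)) a + axis i (3 ^ (12 - j)) a - axis y (3 ^ (12 - 2 * i - 2 * j)) a))
      \<and> modulus dvd (\<Sum>a\<leftarrow>[0..<7]. coefficient b a c * (axis j (3 ^ (12 - i)) a + axis i (3 ^ (12 - j)) a - axis y (3 ^ (12 - 2 * i - 2 * j)) a)))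
    [0..<7]) [0..<7]) [(0, 1, 7), (0, 2, 4), (1, 3, 5), (2, 3, 6)]"
    by code_simp
  then show ?thesis
    by (simp add: null_vectors_def list_all_iff interv_sum_list_conv_sum_set_nat atLeast0LessThan del: upt_Suc)
qed

section \<open>Presented groups and strongly central series\<close>

locale free_group_hom =
  fixes X :: "'x set" and h :: "'x word \<Rightarrow> 'g::group_add"
  assumes hom_mult: "u \<in> carrier (free_group X) \<Longrightarrow> v \<in> carrier (free_group X)
    \<Longrightarrow> h (u \<otimes>\<^bsub>free_group X\<^esub> v) = h u + h v"
begin

sublocale group "free_group X" by (rule group_free_group)

lemma hom_one: "h \<one>\<^bsub>free_group X\<^esub> = 0"
proof -
  have "h \<one>\<^bsub>free_group X\<^esub> + h \<one>\<^bsub>free_group X\<^esub> = h (\<one>\<^bsub>free_group X\<^esub> \<otimes>\<^bsub>free_group X\<^esub> \<one>\<^bsub>free_group X\<^esub>)"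
    by (rule hom_mult[symmetric]) simp_all
  also have "\<dots> = h \<one>\<^bsub>free_group X\<^esub> + 0" by simp
  finally show ?thesis by (rule add_left_imp_eq)
qed

lemma hom_inv: "u \<in> carrier (free_group X) \<Longrightarrow> h (inv\<^bsub>free_group X\<^esub> u) = - h u"
  using hom_mult[of u "inv\<^bsub>free_group X\<^esub> u"] hom_one by (simp add: minus_unique)

lemma commutator_closed:
  "u \<in> carrier (free_group X) \<Longrightarrow> v \<in> carrier (free_group X)
    \<Longrightarrow> commutator (free_group X) u v \<in> carrier (free_group X)"
  by (simp add: commutator_def)

lemma hom_commutator:
  "u \<in> carrier (free_group X) \<Longrightarrow> v \<in> carrier (free_group X)
    \<Longrightarrow> h (commutator (free_group X) u v) = comm (h u) (h v)"
  by (simp add: commutator_def comm_def hom_mult hom_inv)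

lemma hom_pow: "u \<in> carrier (free_group X) \<Longrightarrow> h (u [^]\<^bsub>free_group X\<^esub> n) = nmul n (h u)"
  for n :: nat
  by (induction n) (simp_all add: hom_one hom_mult)

end

fun word_value :: "('x \<Rightarrow> 'g::group_add) \<Rightarrow> 'x word \<Rightarrow> 'g" where
  "word_value f [] = 0"
| "word_value f ((x, b) # w) = (if b then f x else - f x) + word_value f w"

lemma word_value_cons_letter:
  "word_value f (cons_letter l w) = word_value f [l] + word_value f w"
proof (cases w)
  case (Cons m w')
  then show ?thesis by (cases l; cases m) (auto simp flip: add.assoc)
qed simp

lemma word_value_foldr:
  "word_value f (foldr cons_letter u v) = word_value f u + word_value f v"
proof (induction u)
  case (Cons l u)
  then show ?case by (cases l) (simp add: word_value_cons_letter add.assoc)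
qed simp

lemma free_group_hom_word_value: "free_group_hom X (word_value f)"
  by standard (simp add: free_group_def word_value_foldr)

lemma word_value_free_gen [simp]: "word_value f (free_gen x) = f x"
  by (simp add: free_gen_def)

lemma (in strongly_central) word_value_mem:
  assumes "\<And>x. x \<in> X \<Longrightarrow> f x \<in> F k" "w \<in> carrier (free_group X)"
  shows "word_value f w \<in> F k"
proof -
  have "w \<in> lists (X \<times> UNIV)" using assms(2) by (simp add: free_group_def)
  then show ?thesis
  proof (induction w rule: lists.induct)
    case (Cons l w)
    then show ?case using assms(1) by (cases l) (auto intro: add_mem minus_mem)
  qed (simp add: zero_mem)
qed

text \<open>
  The image of a word in the presented group, as a function of the whole word.
\<close>

definition presented_class :: "'x set \<Rightarrow> ('x word \<times> 'x word) set \<Rightarrow> 'x word \<Rightarrow> 'x word set" where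
  "presented_class X R w = relation_closure X R #>\<^bsub>free_group X\<^esub> w"

locale presentation =
  fixes X :: "'x set" and R :: "('x word \<times> 'x word) set"
  assumes R_closed: "R \<subseteq> carrier (free_group X) \<times> carrier (free_group X)"
begin

abbreviation "FX \<equiv> free_group X"
abbreviation "G \<equiv> presented_group X R"
abbreviation "cls \<equiv> presented_class X R"

sublocale FX: group FX by (rule group_free_group)
sublocale G: group G by (rule group_presented_group[OF R_closed])

lemma normal_relation_closure: "relation_closure X R \<lhd> FX"
  unfolding relation_closure_def using R_closed
  by (intro normal_normal_closure group_free_group) auto

sublocale cls: group_hom FX G cls
  unfolding group_hom_def group_hom_axioms_def presented_group_def presented_class_def
  using normal.r_coset_hom_Mod[OF normal_relation_closure] group_presented_group[OF R_closed]
    group_free_group[of X]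
  by (simp add: presented_group_def)

lemma cls_surj: "C \<in> carrier G \<Longrightarrow> \<exists>w\<in>carrier FX. C = cls w"
  by (auto simp: presented_group_def presented_class_def carrier_FactGroup)

lemma relator_mem:
  assumes "(l, r) \<in> R" shows "l \<otimes>\<^bsub>FX\<^esub> inv\<^bsub>FX\<^esub> r \<in> relation_closure X R"
  unfolding relation_closure_def normal_closure_def
proof (rule generate.incl, rule CollectI, intro exI conjI)
  show "l \<otimes>\<^bsub>FX\<^esub> inv\<^bsub>FX\<^esub> r
    = \<one>\<^bsub>FX\<^esub> \<otimes>\<^bsub>FX\<^esub> (l \<otimes>\<^bsub>FX\<^esub> inv\<^bsub>FX\<^esub> r) \<otimes>\<^bsub>FX\<^esub> inv\<^bsub>FX\<^esub> \<one>\<^bsub>FX\<^esub>"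
    using assms R_closed by auto
qed (use assms in auto)

lemma cls_relation:
  assumes "(l, r) \<in> R" shows "cls l = cls r"
proof -
  have lr: "l \<in> carrier FX" "r \<in> carrier FX" using assms R_closed by auto
  interpret N: normal "relation_closure X R" FX by (rule normal_relation_closure)
  have "cls (l \<otimes>\<^bsub>FX\<^esub> inv\<^bsub>FX\<^esub> r) = \<one>\<^bsub>G\<^esub>"
    using relator_mem[OF assms] lr
    by (simp add: presented_class_def presented_group_def FX.coset_join2 N.subgroup_axioms)
  then show ?thesis using lr by (simp add: G.inv_equality[symmetric] cls.hom_inv G.inv_solve_right')
qed

lemma cls_commutator:
  "u \<in> carrier FX \<Longrightarrow> v \<in> carrier FX \<Longrightarrow> cls (commutator FX u v) = commutator G (cls u) (cls v)"
  by (simp add: commutator_def cls.hom_inv)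


end

text \<open>
  Evaluation of words maps the relation closure into \<open>F n\<close>, so every element of the presented group has a
  value modulo \<open>F n\<close>; by induction, elements of the \<open>k\<close>-th term of the lower central series have a
  representative with value in \<open>F k\<close>.
\<close>

theorem (in strongly_central) word_value_mem_of_lower_central:
  assumes R: "R \<subseteq> carrier (free_group X) \<times> carrier (free_group X)"
    and gens: "\<And>x. x \<in> X \<Longrightarrow> f x \<in> F 1"
    and rels: "\<And>l r. (l, r) \<in> R \<Longrightarrow> word_value f l - word_value f r \<in> F n"
    and w: "w \<in> carrier (free_group X)" "presented_class X R w \<in> lower_central (presented_group X R) n"
    and n: "n \<ge> 1"
  shows "word_value f w \<in> F n"
proof -
  interpret presentation X R by unfold_locales fact
  interpret V: free_group_hom X "word_value f" by (rule free_group_hom_word_value)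
  have F1: "word_value f u \<in> F 1" if "u \<in> carrier FX" for u
    using gens that by (rule word_value_mem)
  have conjugate: "h \<in> carrier FX \<and> word_value f h \<in> F n"
    if "h \<in> {g \<otimes>\<^bsub>FX\<^esub> r \<otimes>\<^bsub>FX\<^esub> inv\<^bsub>FX\<^esub> g | g r.
      g \<in> carrier FX \<and> r \<in> (\<lambda>(l, r). l \<otimes>\<^bsub>FX\<^esub> inv\<^bsub>FX\<^esub> r) ` R}" for h
  proof -
    from that obtain g l r where h: "h = g \<otimes>\<^bsub>FX\<^esub> (l \<otimes>\<^bsub>FX\<^esub> inv\<^bsub>FX\<^esub> r) \<otimes>\<^bsub>FX\<^esub> inv\<^bsub>FX\<^esub> g"
      and g: "g \<in> carrier FX" and lr: "(l, r) \<in> R" by auto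
    have "l \<in> carrier FX" "r \<in> carrier FX" using lr R by auto
    then show ?thesis
      using g conj_mem'[OF rels[OF lr] F1[OF g]] by (simp add: h V.hom_mult V.hom_inv)
  qed
  have closure: "u \<in> carrier FX \<and> word_value f u \<in> F n" if "u \<in> relation_closure X R" for u
    using that unfolding relation_closure_def normal_closure_def
  proof (induction rule: generate.induct)
    case (incl h)
    then show ?case by (rule conjugate)
  next
    case (inv h)
    then show ?case using conjugate[OF inv] by (simp add: V.hom_inv minus_mem)
  next
    case (eng h1 h2)
    then show ?case by (simp add: V.hom_mult add_mem)
  qed (simp add: V.hom_one zero_mem)
  have main: "\<exists>u\<in>carrier FX. C = cls u \<and> word_value f u \<in> F k" if "C \<in> lower_central G k" "1 \<le> k" for C k
    using that(2,1)
  proof (induction k arbitrary: C rule: nat_induct_at_least)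
    case base
    then show ?case using cls_surj F1 by fastforce
  next
    case (Suc k)
    have "lower_central G (Suc k) = generate G {commutator G x g | x g. x \<in> lower_central G k \<and> g \<in> carrier G}"
      using Suc(1) by (cases k) auto
    with Suc(3) have C: "C \<in> generate G {commutator G x g | x g. x \<in> lower_central G k \<and> g \<in> carrier G}"
      by simp
    have gen: "\<exists>u\<in>carrier FX. C = cls u \<and> word_value f u \<in> F (Suc k)"
      if "C \<in> {commutator G x g | x g. x \<in> lower_central G k \<and> g \<in> carrier G}" for C
    proof -
      from that obtain x g where C: "C = commutator G x g" and "x \<in> lower_central G k" "g \<in> carrier G" by blast
      then obtain u v where u: "u \<in> carrier FX" "x = cls u" "word_value f u \<in> F k"
        and v: "v \<in> carrier FX" "g = cls v" using Suc(2) cls_surj by metis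
      then show ?thesis
        using comm_mem[OF u(3) F1[OF v(1)]]
        by (intro bexI[of _ "commutator FX u v"]) (simp_all add: C cls_commutator V.hom_commutator V.commutator_closed)
    qed
    from C show ?case
    proof (induction rule: generate.induct)
      case one
      show ?case by (intro bexI[of _ "\<one>\<^bsub>FX\<^esub>"]) (simp_all add: V.hom_one zero_mem)
    next
      case (incl h)
      then show ?case by (rule gen)
    next
      case (inv h)
      from gen[OF inv] obtain u where "u \<in> carrier FX" "h = cls u" "word_value f u \<in> F (Suc k)" by blast
      then show ?case
        by (intro bexI[of _ "inv\<^bsub>FX\<^esub> u"]) (simp_all add: V.hom_inv cls.hom_inv minus_mem)
    next
      case (eng h1 h2)
      then obtain u v where "u \<in> carrier FX" "h1 = cls u" "word_value f u \<in> F (Suc k)"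
        "v \<in> carrier FX" "h2 = cls v" "word_value f v \<in> F (Suc k)" by blast
      then show ?case
        by (intro bexI[of _ "u \<otimes>\<^bsub>FX\<^esub> v"]) (simp_all add: V.hom_mult add_mem)
    qed
  qed
  from main[OF w(2) n] obtain u where u: "u \<in> carrier FX" "cls w = cls u" "word_value f u \<in> F n" by blast
  have "w \<in> relation_closure X R #>\<^bsub>FX\<^esub> u"
    using u(2) w(1) FX.rcos_self[OF w(1), of "relation_closure X R"] normal_relation_closure
    by (simp add: presented_class_def normal_imp_subgroup)
  then obtain v where "v \<in> relation_closure X R" "w = v \<otimes>\<^bsub>FX\<^esub> u"
    by (auto simp: r_coset_def)
  then show ?thesis using closure u by (simp add: V.hom_mult add_mem)
qed

section \<open>The word is not in the seventh term\<close>

text \<open>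
  The index 7 lies outside the range of \<open>tensor\<close>, so that \<open>y\<^sub>0\<^sub>1\<close> becomes trivial.
\<close>

fun pair_index :: "nat \<times> nat \<Rightarrow> nat" where
  "pair_index p = (if p = (0, 2) then 4 else if p = (1, 3) then 5 else if p = (2, 3) then 6 else 7)"

text \<open>
  The roles of \<open>a\<^sub>i, b\<^sub>i\<close> and \<open>u\<^sub>i\<^sub>j, v\<^sub>i\<^sub>j, w\<^sub>i\<^sub>j\<close> are those in \<open>comm_q\<close> and \<open>comm_q_binomial\<close>: a map on \<open>\<int>\<close> whose first
  or second difference is the required element, and translations.
\<close>

fun generator_value :: "gen \<Rightarrow> ((int, nat \<Rightarrow> int) wreath, int) wreath" where
  "generator_value (Ge i) = diagonal (lift (axis i 1))"
| "generator_value (Ga i) = Wr (\<lambda>n. lift (axis i (9 ^ i * n))) 0"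
| "generator_value (Gb i) = Wr 0 (- 1)"
| "generator_value (Gu i j) = Wr (\<lambda>n. lift (axis (pair_index (i, j)) (n * (n - 1) div 2))) 0"
| "generator_value (Gv i j) = Wr 0 (- 1)"
| "generator_value (Gw i j) = Wr 0 (- 1)"

interpretation series: strongly_central series
  by (rule strongly_central_series)

interpretation wreath_series: strongly_central
  "wreath_series series :: nat \<Rightarrow> ((int, nat \<Rightarrow> int) wreath, int) wreath set"
  by (rule strongly_central_wreath_series[OF strongly_central_series])

lemma one_parameter_axis: "one_parameter series (\<lambda>n. lift (axis i (c * n)))"
  by unfold_locales (simp add: distrib_left lift_axis_add)

lemma generator_value_mem:
  assumes "x \<in> gens" shows "generator_value x \<in> wreath_series series 1"
proof -
  have translation: "Wr 0 (- 1) \<in> wreath_series series 1"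
    using strongly_central.zero_mem[OF strongly_central_polynomial_maps[OF strongly_central_series]]
    by simp
  have "generator_value (Ge i) \<in> wreath_series series 1" for i
    by (auto simp: diagonal_mem_wreath_series[OF strongly_central_series] scale_def
        intro!: lift_mem_series axis_mem_lattice)
  moreover have "generator_value (Ga i) \<in> wreath_series series 1" if "i \<le> 3" for i
  proof -
    interpret one_parameter series "\<lambda>n. lift (axis i (9 ^ i * n))" by (rule one_parameter_axis)
    show ?thesis using that
      by (auto simp: scale_def intro!: q_polynomial lift_mem_series axis_mem_lattice)
  qed
  moreover have "generator_value (Gu i j) \<in> wreath_series series 1" for i j
  proof -
    interpret one_parameter series "\<lambda>n. lift (axis (pair_index (i, j)) (1 * n))" by (rule one_parameter_axis)
    have "lift (axis (pair_index (i, j)) n) \<in> series (Suc (Suc 1))" for n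
      by (intro lift_mem_series axis_mem_lattice) (auto simp: scale_def)
    then show ?thesis using q_binomial_polynomial[of 1] by (simp del: pair_index.simps)
  qed
  ultimately show ?thesis using assms translation by (auto simp: gens_def simp del: pair_index.simps)
qed

lemma comm_generator_values:
  "comm (generator_value (Ga i)) (generator_value (Gb i)) = diagonal (lift (axis i (9 ^ i)))"
  "comm (comm (generator_value (Gu i j)) (generator_value (Gv i j))) (generator_value (Gw i j))
    = diagonal (lift (axis (pair_index (i, j)) 1))"
proof -
  interpret a: one_parameter series "\<lambda>n. lift (axis i (9 ^ i * n))" by (rule one_parameter_axis)
  interpret u: one_parameter series "\<lambda>n. lift (axis (pair_index (i, j)) (1 * n))" by (rule one_parameter_axis)
  show "comm (generator_value (Ga i)) (generator_value (Gb i)) = diagonal (lift (axis i (9 ^ i)))"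
    using a.comm_q by simp
  show "comm (comm (generator_value (Gu i j)) (generator_value (Gv i j))) (generator_value (Gw i j))
    = diagonal (lift (axis (pair_index (i, j)) 1))"
    using u.comm_q u.comm_q_binomial by (simp del: pair_index.simps)
qed

lemma nmul_diagonal: "nmul n (diagonal x) = diagonal (nmul n x)"
  by (induction n) (simp_all add: diagonal_add)

lemma nmul_lift_axis: "nmul n (lift (axis i c)) = lift (axis i (int n * c))"
proof (induction n)
  case 0
  have "axis i 0 = 0" by (auto simp: axis_def)
  then show ?case by (simp only: nmul.simps of_nat_0 mult_zero_left lift_zero)
qed (simp add: distrib_right lift_axis_add[symmetric] add.commute)

text \<open>
  The lift is additive up to the last term \<open>series 7\<close> on the two summands because the product of the exponents is divisible
  by the modulus, and null vectors lift into the last term \<open>series 7\<close>.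
\<close>

lemma lift_pair_relator:
  assumes r: "axis j A + axis i B - axis y C \<in> null_vectors" and AB: "modulus dvd A * B"
  shows "lift (axis j A) + lift (axis i B) - lift (axis y C) \<in> series 7"
proof -
  let ?r = "axis j A + axis i B - axis y C"
  let ?l = "lift (axis j A)" and ?l' = "lift (axis i B)" and ?c = "lift (axis y C)"
  have s: "axis j A + axis i B = axis y C + ?r" by simp
  have 1: "?l + ?l' - lift (axis j A + axis i B) \<in> series 7"
    using AB by (intro lift_add_cong) (auto simp: tensor_axis mult.commute)
  have 2: "?c + lift ?r - lift (axis y C + ?r) \<in> series 7"
    by (rule lift_add_cong) (rule tensor_null(1)[OF r])
  have "?r \<in> lattice 7" 
    unfolding lattice_def using r by (intro CollectI exI[of _ "0 :: nat \<Rightarrow> int"] exI[of _ ?r]) auto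
  then have 3: "?c + lift ?r - ?c \<in> series 7"
    using series.conj_mem'[OF lift_mem_series lift_mem_series, of ?r 7 "axis y C" 0] M_0 by simp
  have "?l + ?l' - ?c = (?l + ?l' - lift (axis j A + axis i B))
      - (?c + lift ?r - lift (axis y C + ?r)) + (?c + lift ?r - ?c)"
    unfolding s[symmetric] by (simp add: group_nf del: add_uminus_conv_diff)
  then show ?thesis using series.add_mem[OF series.diff_mem[OF 1 2] 3] by simp
qed

interpretation val: free_group_hom gens "word_value generator_value"
  by (rule free_group_hom_word_value)

lemma gens_mem:
  "i \<le> 3 \<Longrightarrow> Ge i \<in> gens" "i \<le> 3 \<Longrightarrow> Ga i \<in> gens" "i \<le> 3 \<Longrightarrow> Gb i \<in> gens"
  "i < j \<Longrightarrow> j \<le> 3 \<Longrightarrow> Gu i j \<in> gens" "i < j \<Longrightarrow> j \<le> 3 \<Longrightarrow> Gv i j \<in> gens"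
  "i < j \<Longrightarrow> j \<le> 3 \<Longrightarrow> Gw i j \<in> gens"
  by (auto simp: gens_def)

lemmas gens_closed = gens_mem[THEN free_gen_closed]


lemma value_relation_single:
  assumes "i \<le> 3"
  shows "word_value generator_value (free_gen (Ge i) [^]\<^bsub>FG\<^esub> (3 ^ (2 * i) :: nat))
    = word_value generator_value (y_single i)"
proof -
  have "int (3 ^ (2 * i)) = 9 ^ i" by (simp add: power_mult)
  then show ?thesis
    using assms unfolding y_single_def
    by (simp add: val.hom_pow val.hom_commutator gens_closed comm_generator_values(1)
        nmul_diagonal nmul_lift_axis del: generator_value.simps(2,3))
qed

lemma value_relation_pair:
  assumes ij: "(i, j) \<in> {(0, 1), (0, 2), (1, 3), (2, 3)}"
  shows "word_value generator_value
      (free_gen (Ge j) [^]\<^bsub>FG\<^esub> (3 ^ (12 - i) :: nat) \<otimes>\<^bsub>FG\<^esub> free_gen (Ge i) [^]\<^bsub>FG\<^esub> (3 ^ (12 - j) :: nat))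
    - word_value generator_value (y_pair i j [^]\<^bsub>FG\<^esub> (3 ^ (12 - 2 * i - 2 * j) :: nat))
    \<in> wreath_series series 7"
proof -
  have le: "i \<le> 3" "j \<le> 3" "i < j" using ij by auto
  have "y_pair i j \<in> carrier FG"
    unfolding y_pair_def using le by (intro val.commutator_closed gens_closed)
  then have "word_value generator_value (y_pair i j [^]\<^bsub>FG\<^esub> (3 ^ (12 - 2 * i - 2 * j) :: nat))
      = diagonal (lift (axis (pair_index (i, j)) (3 ^ (12 - 2 * i - 2 * j))))"
    unfolding y_pair_def using le
    by (simp add: val.hom_pow val.hom_commutator val.commutator_closed gens_closed
        comm_generator_values(2) nmul_diagonal nmul_lift_axis
        del: generator_value.simps(4,5,6) pair_index.simps)
  moreover have "word_value generator_value
      (free_gen (Ge j) [^]\<^bsub>FG\<^esub> (3 ^ (12 - i) :: nat) \<otimes>\<^bsub>FG\<^esub> free_gen (Ge i) [^]\<^bsub>FG\<^esub> (3 ^ (12 - j) :: nat))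
    = diagonal (lift (axis j (3 ^ (12 - i))) + lift (axis i (3 ^ (12 - j))))"
    using le
    by (simp add: val.hom_mult val.hom_pow gens_closed diagonal_add nmul_diagonal nmul_lift_axis)
  moreover have "lift (axis j (3 ^ (12 - i))) + lift (axis i (3 ^ (12 - j)))
      - lift (axis (pair_index (i, j)) (3 ^ (12 - 2 * i - 2 * j))) \<in> series 7"
    using ij relators_null by (intro lift_pair_relator) (auto simp: modulus_def power_add[symmetric] intro!: le_imp_power_dvd)
  ultimately show ?thesis
    by (simp add: diagonal_mem_wreath_series[OF strongly_central_series]
        del: pair_index.simps add_uminus_conv_diff flip: diagonal_minus diagonal_add add: diff_conv_add_uminus)
qed

lemma value_rels:
  assumes "(l, r) \<in> rels"
  shows "word_value generator_value l - word_value generator_value r \<in> wreath_series series 7"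
  using assms unfolding rels_def
proof (elim UnE)
  assume "(l, r) \<in> {(free_gen (Ge i) [^]\<^bsub>FG\<^esub> (3 ^ (2 * i) :: nat), y_single i) | i. i \<in> {0, 1, 2, 3}}"
  then obtain i where "l = free_gen (Ge i) [^]\<^bsub>FG\<^esub> (3 ^ (2 * i) :: nat)" "r = y_single i"
    and "i \<in> {0, 1, 2, 3}" by blast
  moreover from this(3) have "i \<le> 3" by auto
  ultimately show ?thesis
    using value_relation_single wreath_series.zero_mem[of 7] by (simp only: diff_self)
qed (use value_relation_pair in blast)

definition omega_word :: "gen word" where
  "omega_word = commutator FG (commutator FG (free_gen (Ge 2)) (free_gen (Ge 1))) (free_gen (Ge 0)) [^]\<^bsub>FG\<^esub> (3 ^ 9 :: nat)"

lemma omega_word_closed: "omega_word \<in> carrier FG"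
  unfolding omega_word_def
  by (intro val.nat_pow_closed val.commutator_closed gens_closed) auto

lemma value_omega_word: "word_value generator_value omega_word \<notin> wreath_series series 7"
proof -
  let ?c = "2 * (tensor (axis 2 1) (axis 1 1) (axis 0 1) - tensor (axis 1 1) (axis 2 1) (axis 0 1))"
  have "nmul n (Wr (\<lambda>_. c) 0) = Wr (\<lambda>_. int n * c) (0 :: nat \<Rightarrow> int)" for n and c :: int
    by (induction n) (auto simp: fun_eq_iff translate_def distrib_right)
  then have "word_value generator_value omega_word = diagonal (Wr (\<lambda>_. int (3 ^ 9) * ?c) 0)"
    unfolding omega_word_def
    by (simp add: val.hom_pow val.hom_commutator val.commutator_closed gens_closed
        triple_comm_lift nmul_diagonal del: of_nat_power of_nat_numeral flip: diagonal_comm)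
  moreover have "\<not> modulus dvd int (3 ^ 9) * ?c"
  proof -
    have "coefficient 2 1 0 = 0" "coefficient 1 2 0 = 81" by code_simp+
    moreover have "(\<Sum>k<7. f k * axis 0 1 k) = f 0" for f
      by (simp add: axis_def if_distrib cong: if_cong)
    ultimately have "?c = - 162" by (simp add: tensor_axis)
    then show ?thesis by (simp add: modulus_def)
  qed
  ultimately show ?thesis
    using const_not_mem_series by (auto simp: diagonal_mem_wreath_series[OF strongly_central_series])
qed

section \<open>The presented group as an additive group\<close>

interpretation pres: presentation gens rels
  by unfold_locales (rule rels_closed)

text \<open>
  A type for the presented group makes the additive calculus available.
\<close>

typedef pres_group = "carrier (presented_group gens rels)"
  using pres.G.one_closed by blast

setup_lifting type_definition_pres_group

instantiation pres_group :: group_add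
begin

lift_definition zero_pres_group :: pres_group is "\<one>\<^bsub>presented_group gens rels\<^esub>" by simp
lift_definition plus_pres_group :: "pres_group \<Rightarrow> pres_group \<Rightarrow> pres_group"
  is "\<lambda>x y. x \<otimes>\<^bsub>presented_group gens rels\<^esub> y" by simp
lift_definition uminus_pres_group :: "pres_group \<Rightarrow> pres_group"
  is "\<lambda>x. inv\<^bsub>presented_group gens rels\<^esub> x" by simp
lift_definition minus_pres_group :: "pres_group \<Rightarrow> pres_group \<Rightarrow> pres_group"
  is "\<lambda>x y. x \<otimes>\<^bsub>presented_group gens rels\<^esub> inv\<^bsub>presented_group gens rels\<^esub> y" by simp

instance
  by standard (transfer; simp add: pres.G.m_assoc)+

end

lemma Rep_comm: "Rep_pres_group (comm x y)
    = commutator (presented_group gens rels) (Rep_pres_group x) (Rep_pres_group y)"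
  unfolding comm_def commutator_def add_uminus_conv_diff[symmetric]
  by (simp add: plus_pres_group.rep_eq uminus_pres_group.rep_eq del: add_uminus_conv_diff)

lemma Rep_nmul: "Rep_pres_group (nmul n x) = Rep_pres_group x [^]\<^bsub>presented_group gens rels\<^esub> n"
  by (induction n) (simp_all add: zero_pres_group.rep_eq plus_pres_group.rep_eq)

lemma (in group) lower_central_subset: "lower_central G n \<subseteq> carrier G"
proof (induction n rule: induct_nat_012)
  case (ge2 n)
  then show ?case
    unfolding lower_central.simps by (intro generate_incl) (force simp: commutator_def)
qed simp_all

lemma Rep_lower_central:
  "x \<in> lower_central_add n \<Longrightarrow> Rep_pres_group x \<in> lower_central (presented_group gens rels) n"
proof (induction n arbitrary: x rule: induct_nat_012)
  case (ge2 n)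
  show ?case
    using ge2(3) unfolding lower_central_add.simps lower_central.simps
  proof (induction rule: subgroup_hull.induct)
    case hull_zero
    show ?case unfolding zero_pres_group.rep_eq by (rule generate.one)
  next
    case (hull_base a)
    then obtain x g where "a = comm x g" "x \<in> lower_central_add (Suc n)" by blast
    then show ?case
      using ge2(2)[of x] Rep_pres_group[of g] by (intro generate.incl) (auto simp: Rep_comm)
  next
    case (hull_add x y)
    then show ?case unfolding plus_pres_group.rep_eq by (intro generate.eng)
  next
    case (hull_minus x)
    have "{commutator (presented_group gens rels) x g | x g.
        x \<in> lower_central (presented_group gens rels) (Suc n) \<and> g \<in> carrier (presented_group gens rels)}
      \<subseteq> carrier (presented_group gens rels)"
      using pres.G.lower_central_subset by (force simp: commutator_def)
    then show ?case
      unfolding uminus_pres_group.rep_eq using hull_minus(2) by (rule pres.G.generate_m_inv_closed)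
  qed
qed (use Rep_pres_group in auto)

definition pres_class :: "gen word \<Rightarrow> pres_group" where
  "pres_class w = Abs_pres_group (presented_class gens rels w)"

lemma Rep_pres_class: "w \<in> carrier FG \<Longrightarrow> Rep_pres_group (pres_class w) = presented_class gens rels w"
  by (simp add: pres_class_def Abs_pres_group_inverse)

interpretation pres_class: free_group_hom gens pres_class
proof
  fix u v assume uv: "u \<in> carrier FG" "v \<in> carrier FG"
  then show "pres_class (u \<otimes>\<^bsub>FG\<^esub> v) = pres_class u + pres_class v"
    by (simp flip: Rep_pres_group_inject add: plus_pres_group.rep_eq Rep_pres_class)
qed

lemma pres_class_rel: "(l, r) \<in> rels \<Longrightarrow> pres_class l = pres_class r"
  by (simp add: pres_class_def pres.cls_relation)

text \<open>
  The hypotheses of \<open>triple_commutator_torsion\<close> are the defining relations: \<open>e\<^sub>0\<close> and the powers \<open>e\<^sub>1^9, e\<^sub>2^81\<close> are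
  commutators, and the \<open>y\<^sub>i\<^sub>j\<close> are triple commutators.
\<close>

lemma omega_torsion: "nmul 3 (pres_class omega_word) \<in> lower_central_add 7"
proof -
  let ?e = "\<lambda>i. pres_class (free_gen (Ge i))"
  let ?y = "\<lambda>i j. pres_class (y_pair i j)"
  have single: "nmul (3 ^ (2 * i)) (?e i) \<in> lower_central_add 2" if "i \<le> 3" for i
  proof -
    have "(free_gen (Ge i) [^]\<^bsub>FG\<^esub> (3 ^ (2 * i) :: nat), y_single i) \<in> rels"
      using that unfolding rels_def by (intro UnI1) (auto simp: le_Suc_eq numeral_3_eq_3 numeral_2_eq_2)
    then have "nmul (3 ^ (2 * i)) (?e i) = pres_class (y_single i)"
      using pres_class_rel that by (simp add: gens_closed flip: pres_class.hom_pow)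
    also have "\<dots> \<in> lower_central_add (1 + 1)"
      unfolding y_single_def using that
      by (simp only: pres_class.hom_commutator gens_closed) (rule comm_lower_central_add; simp)
    finally show ?thesis by (simp only: one_add_one)
  qed
  have y: "?y i j \<in> lower_central_add 3" if "i < j" "j \<le> 3" for i j
  proof -
    have "comm (comm a b) c \<in> lower_central_add (1 + 1 + 1)" for a b c :: pres_group
      by (rule comm_lower_central_add; (rule comm_lower_central_add)?; simp)
    then show ?thesis
      unfolding y_pair_def using that
      by (simp add: pres_class.hom_commutator pres_class.commutator_closed gens_closed
          numeral_3_eq_3 del: lower_central_add.simps)
  qed
  have pair: "nmul (3 ^ (12 - i)) (?e j) + nmul (3 ^ (12 - j)) (?e i) = nmul (3 ^ (12 - 2 * i - 2 * j)) (?y i j)"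
    if ij: "(i, j) \<in> {(0, 1), (0, 2), (1, 3), (2, 3)}" for i j
  proof -
    have le: "i \<le> 3" "j \<le> 3" "i < j" using ij by auto
    have "y_pair i j \<in> carrier FG"
      unfolding y_pair_def using le by (intro pres_class.commutator_closed gens_closed)
    moreover have "(free_gen (Ge j) [^]\<^bsub>FG\<^esub> (3 ^ (12 - i) :: nat) \<otimes>\<^bsub>FG\<^esub> free_gen (Ge i) [^]\<^bsub>FG\<^esub> (3 ^ (12 - j) :: nat),
       y_pair i j [^]\<^bsub>FG\<^esub> (3 ^ (12 - 2 * i - 2 * j) :: nat)) \<in> rels"
      using ij unfolding rels_def by (intro UnI2) blast
    ultimately show ?thesis
      using pres_class_rel le by (simp add: gens_closed flip: pres_class.hom_pow pres_class.hom_mult)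
  qed
  have "nmul (3 ^ 10) (comm (comm (?e 2) (?e 1)) (?e 0)) \<in> lower_central_add 7"
  proof (rule group_series.triple_commutator_torsion[OF lower_central_add.group_series_axioms])
    show "?e 0 \<in> lower_central_add 2" "nmul 9 (?e 1) \<in> lower_central_add 2"
      "nmul 81 (?e 2) \<in> lower_central_add 2"
      using single[of 0] single[of 1] single[of 2] by simp_all
    show "?y 1 3 \<in> lower_central_add 3" "?y 2 3 \<in> lower_central_add 3"
      by (rule y; simp)+
    show "nmul (3 ^ 11) (?e 3) + nmul (3 ^ 9) (?e 1) = nmul (3 ^ 4) (?y 1 3)"
      "nmul (3 ^ 10) (?e 3) + nmul (3 ^ 9) (?e 2) = nmul (3 ^ 2) (?y 2 3)"
      using pair[of 1 3] pair[of 2 3] by simp_all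
  qed
  moreover have "(3 ^ 10 :: nat) = 3 ^ 9 * 3" by simp
  ultimately have "nmul 3 (nmul (3 ^ 9) (comm (comm (?e 2) (?e 1)) (?e 0))) \<in> lower_central_add 7"
    by (simp only: nmul_mult)
  then show ?thesis
    unfolding omega_word_def
    by (simp only: pres_class.hom_pow pres_class.hom_commutator pres_class.commutator_closed gens_closed)
qed

theorem proposition9p3:
  shows "let G = presented_group gens rels;
             e = (\<lambda>i. presented_gen gens rels (Ge i));
             \<omega> = commutator G (commutator G (e 2) (e 1)) (e 0) [^]\<^bsub>G\<^esub> (3 ^ 9 :: nat)
         in \<omega> \<notin> lower_central G 7 \<and> \<omega> [^]\<^bsub>G\<^esub> (3 :: nat) \<in> lower_central G 7"
proof -
  let ?G = "presented_group gens rels" and ?e = "\<lambda>i. presented_gen gens rels (Ge i)"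
  let ?\<omega> = "commutator ?G (commutator ?G (?e 2) (?e 1)) (?e 0) [^]\<^bsub>?G\<^esub> (3 ^ 9 :: nat)"
  have e: "?e i = presented_class gens rels (free_gen (Ge i))" for i
    by (simp add: presented_gen_def presented_class_def)
  have \<omega>: "?\<omega> = presented_class gens rels omega_word"
    unfolding omega_word_def e
    by (simp add: pres.cls_commutator pres.cls.hom_nat_pow pres_class.commutator_closed gens_closed)
  have "presented_class gens rels omega_word \<notin> lower_central ?G 7"
    using wreath_series.word_value_mem_of_lower_central[OF rels_closed generator_value_mem value_rels
        omega_word_closed] value_omega_word by auto
  moreover have "presented_class gens rels omega_word [^]\<^bsub>?G\<^esub> (3 :: nat) \<in> lower_central ?G 7"
    using Rep_lower_central[OF omega_torsion] by (simp add: Rep_nmul Rep_pres_class omega_word_closed)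
  ultimately show ?thesis unfolding Let_def \<omega> by blast
qed

end
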